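(* Let $n$ be an odd positive integer, write $n=2m-1$, let $x\in\mathbb{R}$ and let $a=(a^0,\dots,a^n)\in\mathbb{R}^{n+1}$. The following statements are equivalent: (1) Problem $\partial CF\mathcal{P}(\mathbb{R})$ with data $x,a$ has a weak solution; (2) Problem $\partial CF\mathcal{P}(\mathbb{R})$ with data $x,a$ has a nontangential solution; (3) Problem $\partial CF\mathcal{P}(\mathbb{R})$ with data $x,a$ has a radial solution; (4) Problem $\partial CF\mathcal{P}(\mathbb{R})$ with data $x,a$ has a solution which is analytic at $x$; (5) the associated Hankel matrix $H_m(a)$ is either positive definite or SE-minimally positive. Moreover, the problem has a unique weak solution if and only if $H_m(a)$ is SE-minimally positive, and in this case the solution is rational of degree equal to $\operatorname{rank} H_m(a)$.
   Context: Let $\Pi=\{z\in\mathbb{C}:\operatorname{Im} z>0\}$. The Pick class $\mathcal{P}$ is the set of analytic functions $f$ on $\Pi$ with $\operatorname{Im} f\ge 0$ on $\Pi$. For $x\in\mathbb{R}$, $z\to x$ nontangentially means that $z\to x$ with $z$ remaining in a set $S\subset\Pi$, with $x$ in the closure of $S$, on which $|z-x|/\operatorname{Im} z$ is bounded (a limit holds nontangentially if it holds along every such $S$). Write $h(z)=o_{\rm nt}((z-x)^n)$ if $h(z)/(z-x)^n\to 0$ as $z\to x$ nontangentially in $\Pi$. Problem $\partial CF\mathcal{P}(\mathbb{R})$ with data $x\in\mathbb{R}$, $a^0,\dots,a^n\in\mathbb{R}$: find $f\in\mathcal{P}$ such that $f$ is analytic at $x$ (i.e. extends analytically to a neighbourhood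 of $x$) and $f^{(k)}(x)/k!=a^k$ for $k=0,1,\dots,n$. Such an $f$ is a solution (analytic at $x$). A function $f\in\mathcal{P}$ is a weak solution of the problem if $f(z)=a^0+a^1(z-x)+\dots+a^n(z-x)^n+o_{\rm nt}((z-x)^n)$. It is a nontangential solution if $f^{(k)}(z)/k!\to a^k$ as $z\to x$ nontangentially in $\Pi$, for $k=0,\dots,n$. It is a radial solution if $\lim_{y\to0+}f^{(k)}(x+\mathrm{i}y)/k!=a^k$ for $k=0,\dots,n$. For $a=(a^0,\dots,a^n)$ and a positive integer $m$ with $2m-1\le n$, $H_m(a)$ is the $m\times m$ Hankel matrix $[a^{i+j-1}]_{i,j=1}^m$ (superscripts are indices). A Hermitian matrix is called positive, written $\ge0$, if it is positive semidefinite. $H_m(a)$ is southeast-minimally (SE-minimally) positive if $H_m(a)\ge0$ and, for every $\varepsilon>0$, $H_m(a)-\operatorname{diag}\{0,\dots,0,\varepsilon\}$ is not positive. The degree of a rational function $p/q$ in lowest terms is $\max(\deg p,\deg q)$, a constant having degree $0$. *)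

theory Defs
  imports
    "HOL-Complex_Analysis.Complex_Analysis"
    "HOL-Computational_Algebra.Polynomial_Factorial"
    "Jordan_Normal_Form.Schur_Decomposition"
    "Jordan_Normal_Form.DL_Rank"
begin

definition upper_half_plane :: "complex set" where
  "upper_half_plane = {z. Im z > 0}"

text \<open>Functions on the upper half-plane are total functions on the complex numbers; their values
  elsewhere are irrelevant, and two of them count as the same if they agree on the half-plane.\<close>

definition pick_class :: "(complex \<Rightarrow> complex) set" where
  "pick_class = {f. f holomorphic_on upper_half_plane \<and> (\<forall>z\<in>upper_half_plane. Im (f z) \<ge> 0)}"

definition nt_approach_set :: "real \<Rightarrow> complex set \<Rightarrow> bool" where
  "nt_approach_set x S \<longleftrightarrow>
     S \<subseteq> upper_half_plane \<and> complex_of_real x \<in> closure S \<and>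
     bounded ((\<lambda>z. cmod (z - complex_of_real x) / Im z) ` S)"

definition nt_tendsto :: "(complex \<Rightarrow> complex) \<Rightarrow> complex \<Rightarrow> real \<Rightarrow> bool" where
  "nt_tendsto h l x \<longleftrightarrow>
     (\<forall>S. nt_approach_set x S \<longrightarrow> (h \<longlongrightarrow> l) (at (complex_of_real x) within S))"

definition nt_small_o :: "(complex \<Rightarrow> complex) \<Rightarrow> nat \<Rightarrow> real \<Rightarrow> bool" where
  "nt_small_o h n x \<longleftrightarrow> nt_tendsto (\<lambda>z. h z / (z - complex_of_real x) ^ n) 0 x"

text \<open>The data of the problem are \<open>x\<close> and \<open>a 0, \<dots>, a n\<close>; the values of \<open>a\<close> beyond \<open>n\<close> are not used.\<close>

definition weak_solution :: "real \<Rightarrow> nat \<Rightarrow> (nat \<Rightarrow> real) \<Rightarrow> (complex \<Rightarrow> complex) \<Rightarrow> bool" where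
  "weak_solution x n a f \<longleftrightarrow>
     f \<in> pick_class \<and>
     nt_small_o
       (\<lambda>z. f z - (\<Sum>k\<le>n. complex_of_real (a k) * (z - complex_of_real x) ^ k)) n x"

definition nontangential_solution ::
    "real \<Rightarrow> nat \<Rightarrow> (nat \<Rightarrow> real) \<Rightarrow> (complex \<Rightarrow> complex) \<Rightarrow> bool" where
  "nontangential_solution x n a f \<longleftrightarrow>
     f \<in> pick_class \<and>
     (\<forall>k\<le>n. nt_tendsto (\<lambda>z. (deriv ^^ k) f z / fact k) (complex_of_real (a k)) x)"

definition radial_solution :: "real \<Rightarrow> nat \<Rightarrow> (nat \<Rightarrow> real) \<Rightarrow> (complex \<Rightarrow> complex) \<Rightarrow> bool" where
  "radial_solution x n a f \<longleftrightarrow>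
     f \<in> pick_class \<and>
     (\<forall>k\<le>n. ((\<lambda>y. (deriv ^^ k) f (Complex x y) / fact k) \<longlongrightarrow> complex_of_real (a k)) (at_right 0))"

text \<open>Here \<open>g\<close> is the analytic extension of \<open>f\<close> to a neighbourhood of \<open>x\<close>, and the derivatives of \<open>f\<close>
  at \<open>x\<close> are those of \<open>g\<close>.\<close>

definition analytic_solution :: "real \<Rightarrow> nat \<Rightarrow> (nat \<Rightarrow> real) \<Rightarrow> (complex \<Rightarrow> complex) \<Rightarrow> bool" where
  "analytic_solution x n a f \<longleftrightarrow>
     f \<in> pick_class \<and>
     (\<exists>g U. open U \<and> complex_of_real x \<in> U \<and> g holomorphic_on U \<and>
        (\<forall>z \<in> U \<inter> upper_half_plane. g z = f z) \<and>
        (\<forall>k\<le>n. (deriv ^^ k) g (complex_of_real x) / fact k = complex_of_real (a k)))"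

text \<open>Matrix indices start at \<open>0\<close>, so the entry \<open>a\<^bsup>i+j-1\<^esup>\<close> with \<open>1 \<le> i, j \<le> m\<close> becomes \<open>a (i + j + 1)\<close>.\<close>

definition hankel :: "nat \<Rightarrow> (nat \<Rightarrow> real) \<Rightarrow> complex mat" where
  "hankel m a = Matrix.mat m m (\<lambda>(i, j). complex_of_real (a (i + j + 1)))"

text \<open>The order on \<^typ>\<open>complex\<close> below is that of \<^theory>\<open>HOL-Library.Complex_Order\<close>: \<open>0 \<le> w\<close> means
  that \<open>w\<close> is real and nonnegative.\<close>

definition pos_semidef_mat :: "complex mat \<Rightarrow> bool" where
  "pos_semidef_mat A \<longleftrightarrow>
     square_mat A \<and> mat_adjoint A = A \<and>
     (\<forall>v \<in> carrier_vec (dim_row A). 0 \<le> (A *\<^sub>v v) \<bullet>c v)"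

definition pos_def_mat :: "complex mat \<Rightarrow> bool" where
  "pos_def_mat A \<longleftrightarrow>
     square_mat A \<and> mat_adjoint A = A \<and>
     (\<forall>v \<in> carrier_vec (dim_row A). v \<noteq> 0\<^sub>v (dim_row A) \<longrightarrow> 0 < (A *\<^sub>v v) \<bullet>c v)"

definition SE_minimally_positive :: "complex mat \<Rightarrow> bool" where
  "SE_minimally_positive A \<longleftrightarrow>
     pos_semidef_mat A \<and>
     (\<forall>\<epsilon>::real. \<epsilon> > 0 \<longrightarrow>
        \<not> pos_semidef_mat
            (A - mat_diag (dim_row A) (\<lambda>i. if i = dim_row A - 1 then complex_of_real \<epsilon> else 0)))"

definition rational_on_upper_half_plane :: "nat \<Rightarrow> (complex \<Rightarrow> complex) \<Rightarrow> bool" where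
  "rational_on_upper_half_plane d f \<longleftrightarrow>
     (\<exists>p q :: complex poly. q \<noteq> 0 \<and> coprime p q \<and>
        max (Polynomial.degree p) (Polynomial.degree q) = d \<and>
        (\<forall>z\<in>upper_half_plane. poly q z \<noteq> 0 \<and> f z = poly p z / poly q z))"

end

theory Submission
  imports
    Defs
    "HOL-Computational_Algebra.Field_as_Ring"
    "Jordan_Normal_Form.DL_Rank_Submatrix"
begin

text \<open>
  Julia's lemma drives an induction on \<open>m\<close>. Let \<open>f\<close> be in the Pick class with a radial expansion
  \<open>a\<^sup>0 + a\<^sup>1 (z - x) + \<dots>\<close> at \<open>x\<close>. If \<open>a\<^sup>1 \<le> 0\<close> then \<open>f\<close> is constant. If \<open>a\<^sup>1 > 0\<close> then Julia's inequality,
  the radial limit of the Schwarz-Pick inequality, says exactly that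
  \<open>g(z) = 1 / (a\<^sup>1 (z - x)) - 1 / (f(z) - a\<^sup>0)\<close> is again in the Pick class, and \<open>g\<close> has an expansion with
  two terms fewer, whose coefficients \<open>b\<close> are determined by \<open>a\<close>. Conversely \<open>f\<close> is recovered from \<open>g\<close>, with
  analyticity at \<open>x\<close> preserved and the degree of a rational function raised by one. On the algebraic side
  \<open>H\<^sub>m(a) = L diag(1 / a\<^sup>1, H\<^sub>m\<^sub>-\<^sub>1(b)) L\<^sup>T\<close> with \<open>L\<close> an invertible lower triangular Toeplitz matrix, so positive
  definiteness and SE-minimal positivity pass between \<open>a\<close> and \<open>b\<close>, and the rank goes up by one. The only
  input about the solution is its expansion along the vertical ray at \<open>x\<close>, which each of the notions of
  solution provides.
\<close>

subsection \<open>Asymptotic expansions along a filter\<close>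

text \<open>The filter is a parameter because the same coefficient calculus is needed twice: on the
  ray, where only the expansion of \<open>f\<close> is available, and on a full punctured
  neighbourhood, where it is Taylor's formula for the extension built in the converse direction.
  Each reduction costs two orders: one for dividing \<open>f z - a 0\<close> by
  \<open>z - x\<close>, one for removing the pole \<open>1 / (a 1 * (z - x))\<close>. This matches
  one row and column of the Hankel matrix. The delicate case is a vanishing leading coefficient.
  Julia's inequality then forces all coefficients from \<open>1\<close> up to
  \<open>2 * m - 1\<close> to vanish, whereas positivity of the matrix only forces those up to
  \<open>2 * m - 2\<close>; the last one is the southeast corner, and SE-minimality is what kills
  it. The same dichotomy decides uniqueness. If every leading coefficient is positive, no condition
  is left after the last one and any real constant can serve as the last reduced function; otherwise
  the chain ends in a constant that the data determine.\<close>

definition expands ::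
    "complex filter \<Rightarrow> complex \<Rightarrow> nat \<Rightarrow> (nat \<Rightarrow> complex) \<Rightarrow> (complex \<Rightarrow> complex) \<Rightarrow> bool" where
  "expands F x n c f \<longleftrightarrow>
     ((\<lambda>z. (f z - (\<Sum>k\<le>n. c k * (z - x) ^ k)) / (z - x) ^ n) \<longlongrightarrow> 0) F"

lemma eventually_neq_of_le_at: "F \<le> at x \<Longrightarrow> eventually (\<lambda>z. z \<noteq> x) F"
  by (erule filter_leD) (simp add: eventually_at_filter)

lemma tendsto_minus_of_le_at:
  "F \<le> at (x::complex) \<Longrightarrow> ((\<lambda>z. z - x) \<longlongrightarrow> 0) F"
  by (erule tendsto_mono) (rule LIM_zero[OF tendsto_ident_at])

lemma expands_0: "expands F x 0 c f \<longleftrightarrow> (f \<longlongrightarrow> c 0) F"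
  by (simp add: expands_def LIM_zero_iff)

lemma expands_cong:
  assumes "eventually (\<lambda>z. f z = g z) F" "\<And>k. k \<le> n \<Longrightarrow> c k = d k"
  shows "expands F x n c f \<longleftrightarrow> expands F x n d g"
  unfolding expands_def
proof (rule filterlim_cong[OF refl refl])
  show "eventually (\<lambda>z. (f z - (\<Sum>k\<le>n. c k * (z - x) ^ k)) / (z - x) ^ n
     = (g z - (\<Sum>k\<le>n. d k * (z - x) ^ k)) / (z - x) ^ n) F"
    using assms(1) by eventually_elim (use assms(2) in simp)
qed

lemma expands_mono: "expands F x n c f \<Longrightarrow> G \<le> F \<Longrightarrow> expands G x n c f"
  unfolding expands_def by (rule tendsto_mono)

text \<open>Removing the constant term and dividing by \<open>z - x\<close> shifts the coefficients;
  the inductions on the order for uniqueness, products and reciprocals rest on this.\<close>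

lemma expands_Suc:
  assumes "F \<le> at x"
  shows "expands F x (Suc n) c f \<longleftrightarrow>
         expands F x n (\<lambda>k. c (Suc k)) (\<lambda>z. (f z - c 0) / (z - x))"
  unfolding expands_def
proof (rule filterlim_cong[OF refl refl])
  show "eventually (\<lambda>z. (f z - (\<Sum>k\<le>Suc n. c k * (z - x) ^ k)) / (z - x) ^ Suc n
     = ((f z - c 0) / (z - x) -
          (\<Sum>k\<le>n. c (Suc k) * (z - x) ^ k)) / (z - x) ^ n) F"
    using eventually_neq_of_le_at[OF assms]
  proof eventually_elim
    case (elim z)
    have "(\<Sum>k\<le>Suc n. c k * (z - x) ^ k) =
       c 0 + (z - x) * (\<Sum>k\<le>n. c (Suc k) * (z - x) ^ k)"
      by (simp only: sum.atMost_Suc_shift sum_distrib_left) (simp add: mult_ac)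
    with elim show ?case by (simp add: field_simps)
  qed
qed

lemma expands_lower_Suc:
  assumes "F \<le> at x" "expands F x (Suc n) c f"
  shows "expands F x n c f"
proof -
  let ?w = "\<lambda>z::complex. z - x"
  let ?R = "\<lambda>z. (f z - (\<Sum>k\<le>Suc n. c k * ?w z ^ k)) / ?w z ^ Suc n"
  have "((\<lambda>z. ?w z * ?R z + c (Suc n) * ?w z) \<longlongrightarrow> 0 * 0 + c (Suc n) * 0) F"
    by (intro tendsto_intros tendsto_minus_of_le_at[OF assms(1)] assms(2)[unfolded expands_def])
  then have *: "((\<lambda>z. ?w z * ?R z + c (Suc n) * ?w z) \<longlongrightarrow> 0) F" by simp
  have "eventually (\<lambda>z. ?w z * ?R z + c (Suc n) * ?w z
    = (f z - (\<Sum>k\<le>n. c k * ?w z ^ k)) / ?w z ^ n) F"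
    using eventually_neq_of_le_at[OF assms(1)]
    by eventually_elim (simp add: field_simps)
  with * show ?thesis unfolding expands_def by (rule Lim_transform_eventually)
qed

lemma expands_lower:
  assumes "F \<le> at x" "expands F x n c f" "k \<le> n"
  shows "expands F x k c f"
  using assms(3,2) by (induction rule: inc_induct) (auto intro: expands_lower_Suc[OF assms(1)])

lemma expands_tendsto:
  assumes "F \<le> at x" "expands F x n c f"
  shows "(f \<longlongrightarrow> c 0) F"
  using expands_lower[OF assms, of 0] by (simp add: expands_0)

lemma expands_unique:
  assumes "F \<le> at x" "F \<noteq> bot" "expands F x n c f" "expands F x n d f" "k \<le> n"
  shows "c k = d k"
  using assms(3-5)
proof (induction n arbitrary: c d f k)
  case 0
  then show ?case using tendsto_unique[OF assms(2)] by (fastforce simp: expands_0)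
next
  case (Suc n)
  have 0: "c 0 = d 0"
    using tendsto_unique[OF assms(2) expands_tendsto[OF assms(1) Suc.prems(1)]
        expands_tendsto[OF assms(1) Suc.prems(2)]] by simp
  show ?case
  proof (cases k)
    case (Suc j)
    then show ?thesis
      using Suc.IH[of "\<lambda>k. c (Suc k)" _ "\<lambda>k. d (Suc k)" j] Suc.prems
      unfolding expands_Suc[OF assms(1)] 0 by auto
  qed (use 0 in simp)
qed

lemma expands_const: "expands F x n (\<lambda>k. if k = 0 then c else 0) (\<lambda>_. c)"
proof -
  have "(\<Sum>k\<le>n. (if k = 0 then c else 0) * (z - x) ^ k) = c" for z :: complex
    by (subst sum.cong[OF refl, of _ _ "\<lambda>k. if k = 0 then c else 0"]) auto
  then show ?thesis by (simp add: expands_def)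
qed

lemma expands_add:
  assumes "expands F x n c f" "expands F x n d g"
  shows "expands F x n (\<lambda>k. c k + d k) (\<lambda>z. f z + g z)"
proof -
  have "(f z - (\<Sum>k\<le>n. c k * (z - x) ^ k)) / (z - x) ^ n +
      (g z - (\<Sum>k\<le>n. d k * (z - x) ^ k)) / (z - x) ^ n =
      (f z + g z - (\<Sum>k\<le>n. (c k + d k) * (z - x) ^ k)) / (z - x) ^ n" for z
    by (simp add: sum.distrib distrib_right add_divide_distrib diff_divide_distrib)
  with tendsto_add[OF assms[unfolded expands_def]] show ?thesis by (simp add: expands_def)
qed

lemma expands_cmult:
  assumes "expands F x n c f"
  shows "expands F x n (\<lambda>k. b * c k) (\<lambda>z. b * f z)"
proof -
  have "b * ((f z - (\<Sum>k\<le>n. c k * (z - x) ^ k)) / (z - x) ^ n) =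
      (b * f z - (\<Sum>k\<le>n. (b * c k) * (z - x) ^ k)) / (z - x) ^ n" for z
    by (simp add: sum_distrib_left right_diff_distrib mult.assoc)
  with tendsto_mult[OF tendsto_const[of "b"] assms[unfolded expands_def]]
  show ?thesis unfolding expands_def by (simp only: mult_zero_right)
qed

lemma expands_mult:
  assumes "F \<le> at x" "expands F x n c f" "expands F x n d g"
  shows "expands F x n (\<lambda>k. \<Sum>i\<le>k. c i * d (k - i)) (\<lambda>z. f z * g z)"
  using assms(2,3)
proof (induction n arbitrary: c d f g)
  case 0
  then show ?case by (auto simp: expands_0 intro: tendsto_mult)
next
  case (Suc n)
  note f = Suc.prems(1)[unfolded expands_Suc[OF assms(1)]]
  note g = Suc.prems(2)[unfolded expands_Suc[OF assms(1)]]
  let ?f = "\<lambda>z. (f z - c 0) / (z - x)"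
  let ?g = "\<lambda>z. (g z - d 0) / (z - x)"
  \<comment> \<open>The split is \<open>f g - c 0 d 0 = (f - c 0) g + c 0 (g - d 0)\<close>; after
    division by \<open>z - x\<close>, order \<open>n\<close> is enough for the factor
    \<open>g\<close>.\<close>
  have "expands F x n (\<lambda>k. (\<Sum>i\<le>k. c (Suc i) * d (k - i)) + c 0 * d (Suc k))
      (\<lambda>z. ?f z * g z + c 0 * ?g z)"
    by (rule expands_add[OF Suc.IH[OF f expands_lower_Suc[OF assms(1) Suc.prems(2)]] expands_cmult[OF g]])
  also have "?this \<longleftrightarrow> expands F x n (\<lambda>k. \<Sum>i\<le>Suc k. c i * d (Suc k - i))
      (\<lambda>z. (f z * g z - (\<Sum>i\<le>0. c i * d (0 - i))) / (z - x))"
  proof (rule expands_cong)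
    show "eventually (\<lambda>z. ?f z * g z + c 0 * ?g z =
       (f z * g z - (\<Sum>i\<le>0. c i * d (0 - i))) / (z - x)) F"
      by (rule always_eventually) (simp add: algebra_simps add_divide_distrib diff_divide_distrib)
    show "(\<Sum>i\<le>k. c (Suc i) * d (k - i)) + c 0 * d (Suc k) = (\<Sum>i\<le>Suc k. c i * d (Suc k - i))" for k
      by (simp only: sum.atMost_Suc_shift) (simp add: add.commute)
  qed
  finally show ?case unfolding expands_Suc[OF assms(1)] .
qed

text \<open>The identity \<open>1 / f - d 0 = - d 0 * (f - c 0) * (1 / f)\<close>, divided by
  \<open>z - x\<close>, lifts the expansion of \<open>1 / f\<close> by one order. The case
  \<open>k = 0\<close> of \<open>conv\<close> also supplies \<open>c 0 \<noteq> 0\<close>.\<close>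

lemma expands_inverse:
  assumes "F \<le> at x" "expands F x n c f"
    and conv: "\<And>k. k \<le> n \<Longrightarrow> (\<Sum>i\<le>k. c i * d (k - i)) = (if k = 0 then 1 else 0)"
  shows "expands F x n d (\<lambda>z. 1 / f z)"
  using assms(2) conv
proof (induction n)
  case 0
  then have cd: "c 0 * d 0 = 1" by force
  then have "c 0 \<noteq> 0" by force
  with cd have "d 0 = 1 / c 0" by (simp add: eq_divide_imp mult.commute)
  with 0 \<open>c 0 \<noteq> 0\<close> show ?case by (auto simp: expands_0 intro!: tendsto_divide)
next
  case (Suc n)
  have cd: "c 0 * d 0 = 1" using Suc.prems(2)[of 0] by force
  then have c0: "c 0 \<noteq> 0" by force
  with cd have d0: "d 0 = 1 / c 0" by (simp add: eq_divide_imp mult.commute)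
  have f0: "(f \<longlongrightarrow> c 0) F" by (rule expands_tendsto[OF assms(1) Suc.prems(1)])
  have ne: "eventually (\<lambda>z. f z \<noteq> 0) F"
    by (rule tendsto_imp_eventually_ne[OF f0]) (use c0 in simp)
  note f = Suc.prems(1)[unfolded expands_Suc[OF assms(1)]]
  have "expands F x n d (\<lambda>z. 1 / f z)"
    by (rule Suc.IH[OF expands_lower_Suc[OF assms(1) Suc.prems(1)] Suc.prems(2)]) simp
  from expands_cmult[OF expands_mult[OF assms(1) f this], of "- d 0"]
  have "expands F x n (\<lambda>k. - d 0 * (\<Sum>i\<le>k. c (Suc i) * d (k - i)))
     (\<lambda>z. (- d 0) * ((f z - c 0) / (z - x) * (1 / f z)))" .
  also have "?this \<longleftrightarrow> expands F x n (\<lambda>k. d (Suc k)) (\<lambda>z. (1 / f z - d 0) / (z - x))"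
  proof (rule expands_cong)
    show "eventually (\<lambda>z. (- d 0) * ((f z - c 0) / (z - x) * (1 / f z)) =
       (1 / f z - d 0) / (z - x)) F"
      using ne eventually_neq_of_le_at[OF assms(1)]
      by eventually_elim (use c0 in \<open>simp add: d0 field_simps\<close>)
    fix k assume "k \<le> n"
    then have "(\<Sum>i\<le>k. c (Suc i) * d (k - i)) = - c 0 * d (Suc k)"
      using Suc.prems(2)[of "Suc k"]
      by (simp only: sum.atMost_Suc_shift) (simp add: eq_neg_iff_add_eq_0 add.commute)
    then show "- d 0 * (\<Sum>i\<le>k. c (Suc i) * d (k - i)) = d (Suc k)"
      using c0 by (simp add: d0)
  qed
  finally show ?case unfolding expands_Suc[OF assms(1)] .
qed

text \<open>By induction the derivative of the remainder is \<open>o((z - x)^n)\<close>, and the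
  mean value inequality along the segment towards \<open>x\<close> integrates this to the next
  order. Star-shapedness keeps the segment in \<open>T\<close>, which will be a ray or a
  ball.\<close>

lemma expands_if_derivs_tendsto:
  assumes "open S" "f holomorphic_on S" "T \<subseteq> S"
    and star: "\<And>z t. z \<in> T \<Longrightarrow> 0 < t \<Longrightarrow> t \<le> 1 \<Longrightarrow> x + of_real t * (z - x) \<in> T"
    and lim: "\<And>k. k \<le> n \<Longrightarrow> ((\<lambda>z. (deriv ^^ k) f z / fact k) \<longlongrightarrow> c k) (at x within T)"
  shows "expands (at x within T) x n c f"
  using assms(2) lim
proof (induction n arbitrary: f c)
  case 0
  then show ?case using 0(2)[of 0] by (simp add: expands_0)
next
  case (Suc n)
  let ?F = "at x within T"
  have lim': "((\<lambda>z. (deriv ^^ k) (deriv f) z / fact k) \<longlongrightarrow> of_nat (Suc k) * c (Suc k)) ?F"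
    if "k \<le> n" for k
  proof -
    have "((\<lambda>z. of_nat (Suc k) * ((deriv ^^ Suc k) f z / fact (Suc k))) \<longlongrightarrow>
       of_nat (Suc k) * c (Suc k)) ?F"
      using that by (intro tendsto_mult tendsto_const Suc.prems(2)) simp
    moreover have "of_nat (Suc k) * ((deriv ^^ Suc k) f z / fact (Suc k)) =
        (deriv ^^ k) (deriv f) z / fact k" for z
      by (simp add: funpow_Suc_right field_simps del: funpow.simps of_nat_Suc)
    ultimately show ?thesis by (simp del: of_nat_Suc)
  qed
  have IH: "expands ?F x n (\<lambda>k. of_nat (Suc k) * c (Suc k)) (deriv f)"
    by (rule Suc.IH[OF holomorphic_deriv[OF Suc.prems(1) assms(1)]]) (rule lim')
  define h where "h = (\<lambda>z. f z - (\<Sum>k\<le>Suc n. c k * (z - x) ^ k))"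
  define h' where "h' = (\<lambda>z. deriv f z - (\<Sum>k\<le>n. of_nat (Suc k) * c (Suc k) * (z - x) ^ k))"
  have der: "(h has_field_derivative h' z) (at z)" if "z \<in> S" for z
  proof -
    have f: "(f has_field_derivative deriv f z) (at z)"
      using Suc.prems(1) assms(1) that holomorphic_derivI by blast
    have mono: "((\<lambda>z. c k * (z - x) ^ k) has_field_derivative
        c k * (of_nat k * (z - x) ^ (k - 1))) (at z)" for k
      by (auto intro!: derivative_eq_intros)
    have "(h has_field_derivative deriv f z - (\<Sum>k\<le>Suc n. c k * (of_nat k * (z - x) ^ (k - 1)))) (at z)"
      unfolding h_def by (intro DERIV_diff f DERIV_sum mono)
    moreover have "(\<Sum>k\<le>Suc n. c k * (of_nat k * (z - x) ^ (k - 1))) =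
        (\<Sum>k\<le>n. of_nat (Suc k) * c (Suc k) * (z - x) ^ k)"
      by (simp only: sum.atMost_Suc_shift) (simp add: mult_ac)
    ultimately show ?thesis by (simp add: h'_def)
  qed
  have hlim: "(h \<longlongrightarrow> 0) ?F"
  proof -
    have "(h \<longlongrightarrow> c 0 - (\<Sum>k\<le>Suc n. c k * (x - x) ^ k)) ?F"
      unfolding h_def using Suc.prems(2)[of 0] by (intro tendsto_intros) simp
    moreover have "(\<Sum>k\<le>Suc n. c k * (x - x) ^ k) = c 0"
      by (simp only: sum.atMost_Suc_shift) simp
    ultimately show ?thesis by simp
  qed
  have "((\<lambda>z. h z / (z - x) ^ Suc n) \<longlongrightarrow> 0) ?F"
  proof (rule tendstoI)
    fix e :: real assume e: "e > 0"
    have "eventually (\<lambda>z. cmod (h' z / (z - x) ^ n) < e / 2) ?F"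
      using tendstoD[OF IH[unfolded expands_def], of "e / 2"] e by (simp add: h'_def)
    then obtain d where d: "d > 0" "\<And>z. z \<in> T \<Longrightarrow> z \<noteq> x \<Longrightarrow> dist z x < d \<Longrightarrow>
        cmod (h' z / (z - x) ^ n) < e / 2"
      by (auto simp: eventually_at)
    have "dist (h z / (z - x) ^ Suc n) 0 < e" if z: "z \<in> T" "z \<noteq> x" "dist z x < d" for z
    proof -
      let ?z = "\<lambda>t. x + complex_of_real t * (z - x)"
      let ?w = "cmod (z - x)"
      have w: "?w > 0" using z by simp
      \<comment> \<open>The remainder need not be differentiable at \<open>x\<close>, so the
        inequality is applied between \<open>z\<close> and a point \<open>?z t\<close> short of
        \<open>x\<close>, and \<open>t\<close> tends to 0 afterwards. The factor
        \<open>e / 2\<close> keeps the final inequality strict.\<close>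
      have bd: "cmod (h (?z t)- h z) \<le> e / 2 * ?w ^ Suc n" if t: "0 < t" "t < 1" for t
      proof -
        have seg: "\<exists>s. 0 < s \<and> s \<le> 1 \<and> y = ?z s" if "y \<in> closed_segment (?z t) z" for y
        proof -
          from that obtain u where u: "0 \<le> u" "u \<le> 1" "y = (1 - u) *\<^sub>R ?z t + u *\<^sub>R z"
            by (auto simp: closed_segment_def)
          have "y = ?z ((1 - u) * t + u)"
            unfolding u(3) scaleR_conv_of_real by (simp add: algebra_simps)
          moreover have "0 < (1 - u) * t + u"
            using u t by (cases "u = 0") (auto intro: add_nonneg_pos)
          moreover have "(1 - u) * t + u \<le> 1"
            using u t mult_left_mono[of t 1 "1 - u"] by simp
          ultimately show ?thesis by blast
        qed
        have "cmod (h (?z t) - h z) \<le> (e / 2 * ?w ^ n) * cmod (?z t - z)"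
        proof (rule field_differentiable_bound[where S = "closed_segment (?z t) z" and f' = h'])
          fix y assume "y \<in> closed_segment (?z t) z"
          then obtain s where s: "0 < s" "s \<le> 1" "y = ?z s" using seg by blast
          have yT: "y \<in> T" unfolding s(3) by (rule star[OF z(1) s(1,2)])
          then show "(h has_field_derivative h' y) (at y within closed_segment (?z t) z)"
            using der assms(3) by (auto intro: has_field_derivative_at_within)
          have yw: "cmod (y - x) = s * ?w" using s by (simp add: norm_mult)
          have "s * ?w \<le> 1 * ?w" using s by (intro mult_right_mono) auto
          with yw have yw': "cmod (y - x) \<le> ?w" by simp
          have "y \<noteq> x" using s z by simp
          moreover have "dist y x < d" using yw' z(3) by (simp add: dist_norm)
          ultimately have "cmod (h' y / (y - x) ^ n) < e / 2" using d(2) yT by blast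
          then have "cmod (h' y) \<le> e / 2 * cmod (y - x) ^ n"
            using \<open>y \<noteq> x\<close> by (simp add: norm_divide norm_power field_simps)
          also have "\<dots> \<le> e / 2 * ?w ^ n"
            using e yw' by (intro mult_left_mono power_mono) auto
          finally show "cmod (h' y) \<le> e / 2 * ?w ^ n" .
        qed auto
        moreover have "cmod (?z t - z) \<le> ?w"
        proof -
          have "?z t - z = of_real (t - 1) * (z - x)" by (simp add: algebra_simps)
          then have "cmod (?z t - z) = (1 - t) * ?w" using t by (simp only: norm_mult norm_of_real) simp
          also have "\<dots> \<le> 1 * ?w" using t by (intro mult_right_mono) auto
          finally show ?thesis by simp
        qed
        then have "(e / 2 * ?w ^ n) * cmod (?z t - z) \<le> (e / 2 * ?w ^ n) * ?w"
          using e by (intro mult_left_mono) auto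
        ultimately show ?thesis by (simp add: mult_ac)
      qed
      have "filterlim ?z ?F (at_right 0)"
        unfolding filterlim_at
      proof
        have "(?z \<longlongrightarrow> x + of_real 0 * (z - x)) (at_right 0)" by (intro tendsto_intros)
        then show "(?z \<longlongrightarrow> x) (at_right 0)" by simp
        show "\<forall>\<^sub>F t in at_right 0. ?z t \<in> T \<and> ?z t \<noteq> x"

          by (rule eventually_mono[OF eventually_at_right_real[of 0 1]]) (use star z in auto)
      qed
      from filterlim_compose[OF hlim this]
      have "((\<lambda>t. cmod (h (?z t) - h z)) \<longlongrightarrow> cmod (0 - h z)) (at_right 0)"
        by (intro tendsto_intros)
      then have "cmod (0 - h z) \<le> e / 2 * ?w ^ Suc n"
        by (rule tendsto_upperbound)
          (rule eventually_mono[OF eventually_at_right_real[of 0 1]], use bd in auto)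
      also have "\<dots> < e * ?w ^ Suc n" using e w by simp
      finally have "cmod (h z) < e * ?w ^ Suc n" by simp
      then have "cmod (h z) / ?w ^ Suc n < e" using w by (simp add: pos_divide_less_eq)
      then show ?thesis by (simp only: dist_norm diff_zero norm_divide norm_power)
    qed
    with d(1) show "eventually (\<lambda>z. dist (h z / (z - x) ^ Suc n) 0 < e) ?F"
      by (auto simp: eventually_at)
  qed
  then show ?case unfolding expands_def h_def .
qed

subsection \<open>Julia's lemma and the reduction of a Pick function\<close>

definition ray :: "real \<Rightarrow> complex set" where
  "ray x = {z. Re z = x \<and> Im z > 0}"

lemma ray_subset_upper_half_plane: "ray x \<subseteq> upper_half_plane"
  by (auto simp: ray_def upper_half_plane_def)

lemma filterlim_Complex_ray: "filterlim (Complex x) (at (of_real x) within ray x) (at_right 0)"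
  unfolding filterlim_at
proof
  have "((\<lambda>y. of_real x + \<i> * of_real y) \<longlongrightarrow> of_real x + \<i> * of_real 0) (at_right 0)"
    by (intro tendsto_intros)
  moreover have "Complex x = (\<lambda>y. of_real x + \<i> * of_real y)" by (simp add: fun_eq_iff Complex_eq)
  ultimately show "(Complex x \<longlongrightarrow> of_real x) (at_right 0)" by simp
  show "\<forall>\<^sub>F y in at_right 0. Complex x y \<in> ray x \<and> Complex x y \<noteq> of_real x"
    by (rule eventually_mono[OF eventually_at_right_less]) (auto simp: ray_def complex_eq_iff)
qed

lemma at_within_ray_neq_bot: "at (of_real x) within ray x \<noteq> bot"
proof
  assume "at (of_real x) within ray x = bot"
  with filterlim_Complex_ray[of x] have "filtermap (Complex x) (at_right 0) = bot"
    by (simp add: filterlim_def le_bot)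
  then show False by (simp add: filtermap_bot_iff)
qed

lemma eventually_at_within_ray:
  "(\<And>z. z \<in> ray x \<Longrightarrow> P z) \<Longrightarrow> eventually P (at (of_real x) within ray x)"
  by (simp add: eventually_at_filter)

lemma tendsto_ray_iff:
  "(h \<longlongrightarrow> l) (at (of_real x) within ray x) \<longleftrightarrow> ((\<lambda>y. h (Complex x y)) \<longlongrightarrow> l) (at_right 0)"
proof
  assume "(h \<longlongrightarrow> l) (at (of_real x) within ray x)"
  then show "((\<lambda>y. h (Complex x y)) \<longlongrightarrow> l) (at_right 0)"
    using filterlim_Complex_ray by (rule filterlim_compose)
next
  assume *: "((\<lambda>y. h (Complex x y)) \<longlongrightarrow> l) (at_right 0)"
  have Im: "filterlim Im (at_right 0) (at (of_real x) within ray x)"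
    unfolding filterlim_at
  proof
    have "(Im \<longlongrightarrow> Im (of_real x)) (at (of_real x) within ray x)" by (intro tendsto_intros)
    then show "(Im \<longlongrightarrow> 0) (at (of_real x) within ray x)" by simp
    show "\<forall>\<^sub>F z in at (of_real x) within ray x. Im z \<in> {0<..} \<and> Im z \<noteq> 0"
      by (rule eventually_at_within_ray) (auto simp: ray_def)
  qed
  have "\<forall>\<^sub>F z in at (of_real x) within ray x. h (Complex x (Im z)) = h z"
    by (rule eventually_at_within_ray) (auto simp: ray_def complex_eq_iff)
  with filterlim_compose[OF * Im] show "(h \<longlongrightarrow> l) (at (of_real x) within ray x)"
    by (rule Lim_transform_eventually)
qed

lemma at_within_ray_le: "at (of_real x) within ray x \<le> at (of_real x)"
  by (rule at_le) simp

lemma open_upper_half_plane: "open upper_half_plane"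
  unfolding upper_half_plane_def by (rule open_halfspace_Im_gt)

lemma connected_upper_half_plane: "connected upper_half_plane"
  unfolding upper_half_plane_def by (intro convex_connected convex_halfspace_Im_gt)

text \<open>By the open mapping theorem a nonconstant \<open>f\<close> would cover a disc about the
  real value \<open>f z\<close> and so take values below the real axis.\<close>

lemma pick_class_Im_eq_0:
  assumes f: "f \<in> pick_class" and z: "z \<in> upper_half_plane" and 0: "Im (f z) = 0"
    and w: "w \<in> upper_half_plane"
  shows "f w = f z"
proof (rule ccontr)
  assume "f w \<noteq> f z"
  then have "\<not> f constant_on upper_half_plane"
    using z w by (metis constant_on_def)
  then have "open (f ` upper_half_plane)"
    using f open_mapping_thm[OF _ open_upper_half_plane connected_upper_half_plane
        open_upper_half_plane order_refl] by (simp add: pick_class_def)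
  then obtain e where e: "e > 0" "ball (f z) e \<subseteq> f ` upper_half_plane"
    using z by (meson imageI openE)
  have "f z - \<i> * of_real (e / 2) \<in> ball (f z) e"
    using e(1) by (simp add: dist_norm norm_mult)
  with e(2) have "f z - \<i> * of_real (e / 2) \<in> f ` upper_half_plane" by blast
  moreover have "Im u \<ge> 0" if "u \<in> f ` upper_half_plane" for u
    using f that by (auto simp: pick_class_def)
  ultimately have "Im (f z - \<i> * of_real (e / 2)) \<ge> 0" by blast
  with 0 e(1) show False by simp
qed

lemma cmod_diff_cnj_squared:
  "(cmod (u - cnj v))\<^sup>2 = (cmod (u - v))\<^sup>2 + 4 * Im u * Im v"
  unfolding cmod_power2 by (simp add: power2_eq_square algebra_simps)

text \<open>This is Schwarz's lemma for \<open>f\<close> conjugated by Cayley transforms that send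
  \<open>w\<close> and \<open>f w\<close> to 0. With the denominators cleared it also covers real
  constants and passes to the limit at the boundary.\<close>

lemma Schwarz_Pick:
  assumes f: "f \<in> pick_class" and z: "z \<in> upper_half_plane" and w: "w \<in> upper_half_plane"
  shows "Im z * Im w * (cmod (f z - cnj (f w)))\<^sup>2 \<le> Im (f z) * Im (f w) * (cmod (z - cnj w))\<^sup>2"
proof (cases "\<exists>u\<in>upper_half_plane. Im (f u) = 0")
  case True
  then obtain u where u: "u \<in> upper_half_plane" "Im (f u) = 0" by blast
  then have "f z = f u" "f w = f u" using pick_class_Im_eq_0 f z w by blast+
  moreover have "cnj (f u) = f u" using u by (simp add: complex_eq_iff)
  ultimately show ?thesis using u by simp
next
  case False
  have pos: "Im (f u) > 0" if "u \<in> upper_half_plane" for u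
    using f False that by (force simp: pick_class_def less_le)
  have Imz: "Im z > 0" and Imw: "Im w > 0" using z w by (auto simp: upper_half_plane_def)
  have ne_cnj: "u - cnj v \<noteq> 0" if "Im u > 0" "Im v > 0" for u v
  proof
    assume "u - cnj v = 0"
    then have "Im (u - cnj v) = 0" by simp
    with that show False by simp
  qed
  have lt: "cmod ((u - v) / (u - cnj v)) < 1" if "Im u > 0" "Im v > 0" for u v
  proof -
    have "(cmod (u - v))\<^sup>2 < (cmod (u - cnj v))\<^sup>2"
      using that by (simp add: cmod_diff_cnj_squared)
    then have "cmod (u - v) < cmod (u - cnj v)" by (rule power_less_imp_less_base) simp
    then show ?thesis using ne_cnj[OF that] by (simp add: norm_divide)
  qed
  \<comment> \<open>The inverse of \<open>z \<mapsto> (z - w) / (z - cnj w)\<close>: it maps the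
    unit disc into the half-plane and 0 to \<open>w\<close>.\<close>
  define C where "C = (\<lambda>t. (w - cnj w * t) / (1 - t))"
  have C: "C t \<in> upper_half_plane" if "cmod t < 1" for t
  proof -
    have "(cmod t)\<^sup>2 < 1" using that by (simp add: abs_square_less_1)
    then have "Re t * Re t + Im t * Im t < 1" unfolding cmod_power2 by (simp add: power2_eq_square)
    then have "Im w * (1 - (Re t * Re t + Im t * Im t)) > 0" using Imw by simp
    also have "Im w * (1 - (Re t * Re t + Im t * Im t)) = Im ((w - cnj w * t) * cnj (1 - t))"
      by (simp add: algebra_simps)
    finally show ?thesis by (simp add: C_def upper_half_plane_def Im_complex_div_gt_0)
  qed
  define \<phi> where "\<phi> = (\<lambda>t. (f (C t) - f w) / (f (C t) - cnj (f w)))"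
  have "C holomorphic_on ball 0 1"
    unfolding C_def by (intro holomorphic_intros) auto
  moreover have "C ` ball 0 1 \<subseteq> upper_half_plane" using C by auto
  ultimately have "(f \<circ> C) holomorphic_on ball 0 1"
    using holomorphic_on_compose_gen[of C "ball 0 1" f upper_half_plane] f
    by (simp add: pick_class_def)
  then have "\<phi> holomorphic_on ball 0 1"
    unfolding \<phi>_def o_def using C pos w by (intro holomorphic_intros ne_cnj) auto
  moreover have "\<phi> 0 = 0" by (simp add: \<phi>_def C_def)
  moreover have "cmod (\<phi> t) < 1" if "cmod t < 1" for t
    unfolding \<phi>_def using C[OF that] pos w by (intro lt) auto
  ultimately have S: "cmod (\<phi> t) \<le> cmod t" if "cmod t < 1" for t
    using Schwarz_Lemma(1) that by blast
  define t where "t = (z - w) / (z - cnj w)"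
  have zw: "z - cnj w \<noteq> 0" and ww: "w - cnj w \<noteq> 0" using ne_cnj Imz Imw by blast+
  have "1 - t = (w - cnj w) / (z - cnj w)" using zw by (simp add: t_def field_simps)
  moreover have "w - cnj w * t = z * ((w - cnj w) / (z - cnj w))"
    using zw by (simp add: t_def field_simps)
  ultimately have "C t = z" using zw ww by (simp add: C_def)
  then have "cmod ((f z - f w) / (f z - cnj (f w))) \<le> cmod ((z - w) / (z - cnj w))"
    using S[of t] lt[OF Imz Imw] by (simp add: t_def \<phi>_def)
  then have "(cmod ((f z - f w) / (f z - cnj (f w))))\<^sup>2 \<le> (cmod ((z - w) / (z - cnj w)))\<^sup>2"
    by (rule power_mono) simp
  then have "(cmod (f z - f w))\<^sup>2 * (cmod (z - cnj w))\<^sup>2 \<le> (cmod (z - w))\<^sup>2 * (cmod (f z - cnj (f w)))\<^sup>2"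
    using zw ne_cnj[OF pos[OF z] pos[OF w]] by (simp add: norm_divide power_divide field_simps)
  \<comment> \<open>After expansion the product of the two plain squared distances occurs on both
    sides and cancels.\<close>
  then show ?thesis unfolding cmod_diff_cnj_squared by (simp add: algebra_simps)
qed

text \<open>Divide Schwarz-Pick by \<open>Im w\<close> and let \<open>w\<close> tend to
  \<open>x\<close> on the ray. There \<open>w - x = \<i> * Im w\<close> and \<open>a 0\<close> is
  real, so \<open>Im (f w) / Im w\<close> is the real part of the difference quotient and tends to
  \<open>a 1\<close>.\<close>

lemma Julia_inequality:
  assumes f: "f \<in> pick_class" and ex: "expands (at (of_real x) within ray x) (of_real x) 1 (\<lambda>k. of_real (a k)) f"
    and z: "z \<in> upper_half_plane"
  shows "Im z * (cmod (f z - of_real (a 0)))\<^sup>2 \<le> a 1 * Im (f z) * (cmod (z - of_real x))\<^sup>2"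
proof -
  let ?F = "at (of_real x) within ray x"
  have f0: "(f \<longlongrightarrow> of_real (a 0)) ?F"
    by (rule expands_tendsto[OF at_within_ray_le ex])
  have "((\<lambda>w. (f w - of_real (a 0)) / (w - of_real x)) \<longlongrightarrow> of_real (a 1)) ?F"
    using ex unfolding One_nat_def expands_Suc[OF at_within_ray_le] expands_0 .
  then have "((\<lambda>w. Re ((f w - of_real (a 0)) / (w - of_real x))) \<longlongrightarrow> Re (of_real (a 1))) ?F"
    by (rule tendsto_Re)
  moreover have "\<forall>\<^sub>F w in ?F. Re ((f w - of_real (a 0)) / (w - of_real x)) = Im (f w) / Im w"
    by (rule eventually_at_within_ray) (auto simp: ray_def Re_divide power2_eq_square)
  ultimately have quot: "((\<lambda>w. Im (f w) / Im w) \<longlongrightarrow> a 1) ?F"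
    by (simp add: filterlim_cong)
  have id: "((\<lambda>w. w) \<longlongrightarrow> of_real x) ?F" by (rule tendsto_ident_at)
  have "((\<lambda>w. Im z * (cmod (f z - cnj (f w)))\<^sup>2) \<longlongrightarrow>
      Im z * (cmod (f z - cnj (of_real (a 0))))\<^sup>2) ?F"
    by (intro tendsto_intros f0)
  moreover have "((\<lambda>w. Im (f z) * (Im (f w) / Im w) * (cmod (z - cnj w))\<^sup>2) \<longlongrightarrow>
      Im (f z) * a 1 * (cmod (z - cnj (of_real x)))\<^sup>2) ?F"
    by (intro tendsto_intros quot)
  moreover have "\<forall>\<^sub>F w in ?F. Im z * (cmod (f z - cnj (f w)))\<^sup>2 \<le>
      Im (f z) * (Im (f w) / Im w) * (cmod (z - cnj w))\<^sup>2"
  proof (rule eventually_at_within_ray)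
    fix w assume "w \<in> ray x"
    then have "w \<in> upper_half_plane" "Im w > 0" by (auto simp: ray_def upper_half_plane_def)
    then show "Im z * (cmod (f z - cnj (f w)))\<^sup>2 \<le> Im (f z) * (Im (f w) / Im w) * (cmod (z - cnj w))\<^sup>2"
      using Schwarz_Pick[OF f z, of w] by (simp add: field_simps)
  qed
  ultimately have "Im z * (cmod (f z - cnj (of_real (a 0))))\<^sup>2 \<le>
      Im (f z) * a 1 * (cmod (z - cnj (of_real x)))\<^sup>2"
    by (intro tendsto_le[OF at_within_ray_neq_bot])
  then show ?thesis by (simp add: mult.commute)
qed

text \<open>For \<open>a 1 \<le> 0\<close> Julia's inequality bounds a nonnegative quantity by a
  nonpositive one. Uniqueness of coefficients settles the rest; in particular a negative
  \<open>a 1\<close> never occurs.\<close>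

lemma pick_class_constant_if_deriv_nonpos:
  assumes f: "f \<in> pick_class" and ex: "expands (at (of_real x) within ray x) (of_real x) n (\<lambda>k. of_real (a k)) f"
    and n: "n \<ge> 1" and a1: "a 1 \<le> 0"
  shows "z \<in> upper_half_plane \<Longrightarrow> f z = of_real (a 0)"
    and "k \<in> {1..n} \<Longrightarrow> a k = 0"
proof -
  show *: "f z = of_real (a 0)" if z: "z \<in> upper_half_plane" for z
  proof -
    have "Im z * (cmod (f z - of_real (a 0)))\<^sup>2 \<le> a 1 * Im (f z) * (cmod (z - of_real x))\<^sup>2"
      by (rule Julia_inequality[OF f expands_lower[OF at_within_ray_le ex n] z])
    also have "\<dots> \<le> 0"
      using a1 f z by (intro mult_nonpos_nonneg) (auto simp: pick_class_def)
    finally have "(cmod (f z - of_real (a 0)))\<^sup>2 \<le> 0"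
      using z by (simp add: upper_half_plane_def mult_le_0_iff)
    then show ?thesis by simp
  qed
  show "a k = 0" if k: "k \<in> {1..n}" for k
  proof -
    have "expands (at (of_real x) within ray x) (of_real x) n (\<lambda>k. if k = 0 then of_real (a 0) else 0) f"
      using expands_const
    proof (rule iffD1[OF expands_cong, rotated 2])
      show "\<forall>\<^sub>F z in at (of_real x) within ray x. of_real (a 0) = f z"
        using * ray_subset_upper_half_plane[of x] by (intro eventually_at_within_ray) auto
    qed simp
    from expands_unique[OF at_within_ray_le at_within_ray_neq_bot ex this, of k] k show ?thesis by simp
  qed
qed

lemma pick_class_ne_boundary_value:
  assumes f: "f \<in> pick_class" and ex: "expands (at (of_real x) within ray x) (of_real x) n (\<lambda>k. of_real (a k)) f"
    and n: "n \<ge> 1" and a1: "a 1 > 0" and z: "z \<in> upper_half_plane"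
  shows "f z \<noteq> of_real (a 0)"
proof
  assume 0: "f z = of_real (a 0)"
  then have "Im (f z) = 0" by simp
  then have eq: "f w = of_real (a 0)" if "w \<in> upper_half_plane" for w
    using pick_class_Im_eq_0[OF f z _ that] 0 by simp
  have "expands (at (of_real x) within ray x) (of_real x) n (\<lambda>k. if k = 0 then of_real (a 0) else 0) f"
    using expands_const
  proof (rule iffD1[OF expands_cong, rotated 2])
    show "\<forall>\<^sub>F z in at (of_real x) within ray x. of_real (a 0) = f z"
      using eq ray_subset_upper_half_plane[of x] by (intro eventually_at_within_ray) auto
  qed simp
  from expands_unique[OF at_within_ray_le at_within_ray_neq_bot ex this n] a1 show False by simp
qed

text \<open>If \<open>a\<close> are the Taylor coefficients of \<open>f\<close> at \<open>x\<close>, then \<open>recip a\<close> are those of \<open>(z - x) / (f z - a 0)\<close>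
  and \<open>reduce a\<close> those of \<open>1 / (a 1 * (z - x)) - 1 / (f z - a 0)\<close>.\<close>

definition recip :: "(nat \<Rightarrow> real) \<Rightarrow> nat \<Rightarrow> real" where
  "recip a = fps_nth (inverse (Abs_fps (\<lambda>k. a (Suc k))))"

definition reduce :: "(nat \<Rightarrow> real) \<Rightarrow> nat \<Rightarrow> real" where
  "reduce a k = - recip a (Suc k)"

lemma recip_0: "recip a 0 = 1 / a 1"
  by (simp add: recip_def divide_inverse)

lemma sum_recip:
  assumes "a 1 \<noteq> 0"
  shows "(\<Sum>i\<le>k. a (Suc i) * recip a (k - i)) = (if k = 0 then 1 else 0)"
proof -
  have "fps_nth (Abs_fps (\<lambda>k. a (Suc k)) * inverse (Abs_fps (\<lambda>k. a (Suc k)))) k = fps_nth 1 k"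
    by (subst inverse_mult_eq_1') (use assms in simp_all)
  then show ?thesis by (simp add: fps_mult_nth recip_def atLeast0AtMost)
qed

text \<open>The two orders of the convolution serve the two directions: inverting the series of
  \<open>f\<close> in the reduction, and inverting the series of \<open>recip a\<close> when
  \<open>f\<close> is recovered.\<close>

lemma sum_recip':
  assumes "a 1 \<noteq> 0"
  shows "(\<Sum>i\<le>k. recip a i * a (Suc (k - i))) = (if k = 0 then 1 else 0)"
proof -
  have "fps_nth (inverse (Abs_fps (\<lambda>k. a (Suc k))) * Abs_fps (\<lambda>k. a (Suc k))) k = fps_nth 1 k"
    by (subst inverse_mult_eq_1) (use assms in simp_all)
  then show ?thesis by (simp add: fps_mult_nth recip_def atLeast0AtMost)
qed

lemma of_real_sum_recip:
  assumes "a 1 \<noteq> 0"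
  shows "(\<Sum>i\<le>k. complex_of_real (a (Suc i)) * of_real (recip a (k - i))) = (if k = 0 then 1 else 0)"
    and "(\<Sum>i\<le>k. complex_of_real (recip a i) * of_real (a (Suc (k - i)))) = (if k = 0 then 1 else 0)"
  using arg_cong[OF sum_recip[of a k, OF assms], of complex_of_real]
    arg_cong[OF sum_recip'[of a k, OF assms], of complex_of_real]
  by simp_all

lemma Im_of_real_divide: "Im (of_real c / z) = - (c * Im z / (cmod z)\<^sup>2)"
  by (simp add: Im_divide cmod_power2)

lemma Im_1_divide: "Im (1 / z) = - Im z / (cmod z)\<^sup>2"
  by (simp add: Im_divide cmod_power2)

lemma pick_class_reduce:
  assumes f: "f \<in> pick_class" and ex: "expands (at (of_real x) within ray x) (of_real x) (Suc (Suc n)) (\<lambda>k. of_real (a k)) f"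
    and a1: "a 1 > 0"
  defines "g \<equiv> \<lambda>z. of_real (1 / a 1) / (z - of_real x) - 1 / (f z - of_real (a 0))"
  shows "g \<in> pick_class"
    and "expands (at (of_real x) within ray x) (of_real x) n (\<lambda>k. of_real (reduce a k)) g"
    and "z \<in> upper_half_plane \<Longrightarrow> f z = of_real (a 0) + 1 / (of_real (1 / a 1) / (z - of_real x) - g z)"
proof -
  let ?F = "at (of_real x) within ray x"
  have ne: "f z \<noteq> of_real (a 0)" if "z \<in> upper_half_plane" for z
    by (rule pick_class_ne_boundary_value[OF f ex _ a1 that]) simp
  have nx: "z \<noteq> of_real x" if "z \<in> upper_half_plane" for z
    using that by (auto simp: upper_half_plane_def)
  have fhol: "f holomorphic_on upper_half_plane" using f by (simp add: pick_class_def)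
  show "g \<in> pick_class"
    unfolding pick_class_def
  proof (intro CollectI conjI ballI)
    show "g holomorphic_on upper_half_plane"
      unfolding g_def using ne nx by (intro holomorphic_intros fhol) auto
    fix z assume z: "z \<in> upper_half_plane"
    have A: "(cmod (f z - of_real (a 0)))\<^sup>2 > 0" and B: "(cmod (z - of_real x))\<^sup>2 > 0"
      using ne[OF z] nx[OF z] by auto
    \<comment> \<open>Divided by \<open>a 1\<close> and the two squared moduli, this is
      \<open>Im (g z) \<ge> 0\<close>.\<close>
    have J: "Im z * (cmod (f z - of_real (a 0)))\<^sup>2 \<le> a 1 * Im (f z) * (cmod (z - of_real x))\<^sup>2"
      by (rule Julia_inequality[OF f expands_lower[OF at_within_ray_le ex] z]) simp
    have "Im (of_real (1 / a 1) / (z - of_real x)) = - (Im z / (a 1 * (cmod (z - of_real x))\<^sup>2))"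
      by (simp only: Im_of_real_divide minus_complex.sel Im_complex_of_real diff_zero mult_1
          times_divide_eq_left divide_divide_eq_left)
    then have "Im (g z) = Im (f z) / (cmod (f z - of_real (a 0)))\<^sup>2 - Im z / (a 1 * (cmod (z - of_real x))\<^sup>2)"
      by (simp add: g_def Im_1_divide)
    moreover have "Im z / (a 1 * (cmod (z - of_real x))\<^sup>2) \<le> Im (f z) / (cmod (f z - of_real (a 0)))\<^sup>2"
      using A B a1 J by (simp add: field_simps)
    ultimately show "Im (g z) \<ge> 0" by simp
  qed
  show "f z = of_real (a 0) + 1 / (of_real (1 / a 1) / (z - of_real x) - g z)"
    if "z \<in> upper_half_plane" for z
    using ne[OF that] by (simp add: g_def)
  have "expands ?F (of_real x) (Suc n) (\<lambda>k. of_real (a (Suc k))) (\<lambda>z. (f z - of_real (a 0)) / (z - of_real x))"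
    using ex unfolding expands_Suc[OF at_within_ray_le] .
  then have "expands ?F (of_real x) (Suc n) (\<lambda>k. of_real (recip a k)) (\<lambda>z. 1 / ((f z - of_real (a 0)) / (z - of_real x)))"
    by (rule expands_inverse[OF at_within_ray_le]) (rule of_real_sum_recip, use a1 in simp)
  then have "expands ?F (of_real x) n (\<lambda>k. - 1 * of_real (recip a (Suc k))) (\<lambda>z. - 1 *
     ((1 / ((f z - of_real (a 0)) / (z - of_real x)) - of_real (recip a 0)) / (z - of_real x)))"
    unfolding expands_Suc[OF at_within_ray_le] by (rule expands_cmult)
  also have "?this \<longleftrightarrow> expands ?F (of_real x) n (\<lambda>k. of_real (reduce a k)) g"
  proof (rule expands_cong)
    have "- 1 * ((1 / ((f z - of_real (a 0)) / (z - of_real x)) - of_real (recip a 0)) / (z - of_real x))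
       = g z" if "z \<in> upper_half_plane" for z
      using ne[OF that] nx[OF that] a1 by (simp add: g_def recip_0 field_simps)
    then show "\<forall>\<^sub>F z in ?F. - 1 *
     ((1 / ((f z - of_real (a 0)) / (z - of_real x)) - of_real (recip a 0)) / (z - of_real x)) = g z"
      using ray_subset_upper_half_plane by (intro eventually_at_within_ray) auto
  qed (simp add: reduce_def)
  finally show "expands ?F (of_real x) n (\<lambda>k. of_real (reduce a k)) g" .
qed

subsection \<open>Hankel forms\<close>

definition quad_form :: "nat \<Rightarrow> (nat \<Rightarrow> nat \<Rightarrow> real) \<Rightarrow> (nat \<Rightarrow> real) \<Rightarrow> real" where
  "quad_form m M v = (\<Sum>i<m. \<Sum>j<m. M i j * v i * v j)"

lemma quad_form_cong:
  assumes "\<And>i. i < m \<Longrightarrow> v i = w i"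
  shows "quad_form m M v = quad_form m M w"
  unfolding quad_form_def by (intro sum.cong refl) (simp add: assms)

text \<open>The entries on the left are those of \<open>L M L^T\<close>, whose form at
  \<open>v\<close> is the form of \<open>M\<close> at \<open>L^T v\<close>.\<close>

lemma quad_form_congruence:
  "quad_form n (\<lambda>i j. \<Sum>p<m. \<Sum>q<m. L i p * L j q * M p q) v =
   quad_form m M (\<lambda>p. \<Sum>i<n. L i p * v i)"
proof -
  have "quad_form n (\<lambda>i j. \<Sum>p<m. \<Sum>q<m. L i p * L j q * M p q) v =
      (\<Sum>(i,j)\<in>{..<n} \<times> {..<n}. \<Sum>(p,q)\<in>{..<m} \<times> {..<m}. L i p * L j q * M p q * v i * v j)"
    by (simp only: quad_form_def sum_distrib_right sum.cartesian_product[symmetric])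
  also have "\<dots> = (\<Sum>(p,q)\<in>{..<m} \<times> {..<m}. \<Sum>(i,j)\<in>{..<n} \<times> {..<n}. L i p * L j q * M p q * v i * v j)"
    unfolding case_prod_unfold by (rule sum.swap)
  also have "\<dots> = (\<Sum>p<m. \<Sum>q<m. \<Sum>i<n. \<Sum>j<n. L i p * L j q * M p q * v i * v j)"
    by (simp only: sum.cartesian_product[symmetric])
  also have "\<dots> = quad_form m M (\<lambda>p. \<Sum>i<n. L i p * v i)"
    unfolding quad_form_def
  proof (intro sum.cong refl)
    fix p q
    have "M p q * (\<Sum>i<n. L i p * v i) * (\<Sum>j<n. L j q * v j) =
        M p q * (\<Sum>i<n. \<Sum>j<n. (L i p * v i) * (L j q * v j))"
      by (simp add: sum_product mult.assoc)
    then show "(\<Sum>i<n. \<Sum>j<n. L i p * L j q * M p q * v i * v j) =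
        M p q * (\<Sum>i<n. L i p * v i) * (\<Sum>j<n. L j q * v j)"
      by (simp add: sum_distrib_left mult_ac)
  qed
  finally show ?thesis .
qed

lemma sum_single:
  "(i::nat) < m \<Longrightarrow> (\<Sum>k<m. f k * (if k = i then t else 0)) = f i * (t::real)"
  by (subst sum.cong[OF refl, of _ _ "\<lambda>k. if k = i then f i * t else 0"]) auto

lemma quad_form_single:
  assumes "i < m"
  shows "quad_form m M (\<lambda>k. if k = i then t else 0) = M i i * t\<^sup>2"
proof -
  have "quad_form m M (\<lambda>k. if k = i then t else 0) =
     (\<Sum>k<m. (\<Sum>l<m. M k l * (if l = i then t else 0)) * (if k = i then t else 0))"
    unfolding quad_form_def sum_distrib_right by (intro sum.cong refl) (simp only: mult_ac)
  then show ?thesis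
    by (simp only: sum_single[OF assms]) (simp add: power2_eq_square)
qed

lemma quad_form_pair:
  assumes "i < m" "j < m" "i \<noteq> j"
  shows "quad_form m M (\<lambda>k. (if k = i then t else 0) + (if k = j then s else 0)) =
         M i i * t\<^sup>2 + (M i j + M j i) * t * s + M j j * s\<^sup>2"
proof -
  have *: "(\<Sum>k<m. f k * ((if k = i then t else 0) + (if k = j then s else 0))) = f i * t + f j * s" for f
    using assms by (simp only: distrib_left sum.distrib sum_single)
  have "quad_form m M (\<lambda>k. (if k = i then t else 0) + (if k = j then s else 0)) =
     (\<Sum>k<m. (\<Sum>l<m. M k l * ((if l = i then t else 0) + (if l = j then s else 0))) *
         ((if k = i then t else 0) + (if k = j then s else 0)))"
    unfolding quad_form_def sum_distrib_right by (intro sum.cong refl) (simp only: mult_ac)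
  also have "\<dots> = (M i i * t + M i j * s) * t + (M j i * t + M j j * s) * s"
    by (simp only: *)
  finally show ?thesis by (simp add: power2_eq_square algebra_simps)
qed

definition psd_form :: "nat \<Rightarrow> (nat \<Rightarrow> nat \<Rightarrow> real) \<Rightarrow> bool" where
  "psd_form m M \<longleftrightarrow> (\<forall>v. quad_form m M v \<ge> 0)"

definition pd_form :: "nat \<Rightarrow> (nat \<Rightarrow> nat \<Rightarrow> real) \<Rightarrow> bool" where
  "pd_form m M \<longleftrightarrow> (\<forall>v. (\<exists>i<m. v i \<noteq> 0) \<longrightarrow> quad_form m M v > 0)"

text \<open>The right-hand side \<open>\<epsilon> * (v (m - 1))\<^sup>2\<close> is the form of the
  subtracted diagonal matrix; failure of positivity is expressed by a violating vector.\<close>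

definition se_form :: "nat \<Rightarrow> (nat \<Rightarrow> nat \<Rightarrow> real) \<Rightarrow> bool" where
  "se_form m M \<longleftrightarrow> psd_form m M \<and> (\<forall>\<epsilon>>0. \<exists>v. quad_form m M v < \<epsilon> * (v (m - 1))\<^sup>2)"

lemma psd_form_diag: "psd_form m M \<Longrightarrow> i < m \<Longrightarrow> M i i \<ge> 0"
  using quad_form_single[of i m M 1] by (simp add: psd_form_def) (metis)

lemma psd_form_zero_row:
  assumes psd: "psd_form m M" and sym: "M i j = M j i" and ij: "i < m" "j < m" and 0: "M i i = 0"
  shows "M i j = 0"
proof (cases "i = j")
  case False
  show ?thesis
  proof (rule ccontr)
    assume ne: "M i j \<noteq> 0"
    \<comment> \<open>Since \<open>M i i = 0\<close>, the form is affine in \<open>t\<close> along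
      \<open>t e_i + e_j\<close>; this \<open>t\<close> gives it the value -1.\<close>
    let ?t = "- (M j j + 1) / (2 * M i j)"
    have "M i i * ?t\<^sup>2 + (M i j + M j i) * ?t * 1 + M j j * 1\<^sup>2 \<ge> 0"
      using psd unfolding psd_form_def quad_form_pair[OF ij False, symmetric] by blast
    with ne show False by (simp add: 0 sym[symmetric])
  qed
qed (use 0 in simp)

section \<open>Complex Hermitian matrices and real quadratic forms\<close>

definition herm_mat :: "nat \<Rightarrow> (nat \<Rightarrow> nat \<Rightarrow> real) \<Rightarrow> complex mat" where
  "herm_mat m M = Matrix.mat m m (\<lambda>(i, j). of_real (M i j))"

lemma herm_mat_carrier: "herm_mat m M \<in> carrier_mat m m"
  by (simp add: herm_mat_def)

lemma mat_adjoint_herm_mat: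
  assumes "\<And>i j. M i j = M j i"
  shows "mat_adjoint (herm_mat m M) = herm_mat m M"
  by (rule eq_matI)
    (use assms in \<open>auto simp: mat_adjoint_def herm_mat_def mat_of_rows_def cols_def\<close>)

text \<open>For a real symmetric matrix the cross terms between the real and imaginary parts of
  \<open>v\<close> cancel, so complex positivity can be tested on real vectors.\<close>

lemma cscalar_prod_herm_mat:
  assumes sym: "\<And>i j. M i j = M j i" and v: "v \<in> carrier_vec m"
  shows "(herm_mat m M *\<^sub>v v) \<bullet>c v =
    of_real (quad_form m M (\<lambda>i. Re (vec_index v i)) + quad_form m M (\<lambda>i. Im (vec_index v i)))"
proof -
  have "(herm_mat m M *\<^sub>v v) \<bullet>c v =
      (\<Sum>i<m. \<Sum>j<m. of_real (M i j) * (vec_index v j * cnj (vec_index v i)))"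
    using v by (simp add: scalar_prod_def herm_mat_def sum_distrib_right atLeast0LessThan mult.assoc)
  also have "\<dots> = of_real (quad_form m M (\<lambda>i. Re (vec_index v i)) + quad_form m M (\<lambda>i. Im (vec_index v i)))"
  proof (rule complex_eqI)
    show "Re (\<Sum>i<m. \<Sum>j<m. of_real (M i j) * (vec_index v j * cnj (vec_index v i))) =
      Re (of_real (quad_form m M (\<lambda>i. Re (vec_index v i)) + quad_form m M (\<lambda>i. Im (vec_index v i))))"
      by (simp add: quad_form_def sum.distrib distrib_left mult_ac)
    have "(\<Sum>i<m. \<Sum>j<m. M i j * (Re (vec_index v j) * Im (vec_index v i))) =
        (\<Sum>j<m. \<Sum>i<m. M i j * (Re (vec_index v j) * Im (vec_index v i)))"
      by (rule sum.swap)
    also have "\<dots> = (\<Sum>i<m. \<Sum>j<m. M i j * (Im (vec_index v j) * Re (vec_index v i)))"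
      by (intro sum.cong refl) (simp add: sym mult.commute)
    finally show "Im (\<Sum>i<m. \<Sum>j<m. of_real (M i j) * (vec_index v j * cnj (vec_index v i))) =
      Im (of_real (quad_form m M (\<lambda>i. Re (vec_index v i)) + quad_form m M (\<lambda>i. Im (vec_index v i))))"
      by (simp add: sum_subtractf right_diff_distrib)
  qed
  finally show ?thesis .
qed

lemma zero_le_of_real_complex: "(0::complex) \<le> of_real r \<longleftrightarrow> 0 \<le> r"
  and zero_less_of_real_complex: "(0::complex) < of_real r \<longleftrightarrow> 0 < r"
  by (simp_all add: less_eq_complex_def less_complex_def)

lemma cscalar_prod_herm_mat_of_real:
  assumes sym: "\<And>i j. M i j = M j i"
  shows "(herm_mat m M *\<^sub>v Matrix.vec m (\<lambda>i. of_real (v i))) \<bullet>c Matrix.vec m (\<lambda>i. of_real (v i)) =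
    of_real (quad_form m M v)"
proof -
  have "quad_form m M (\<lambda>i. Re (vec_index (Matrix.vec m (\<lambda>i. of_real (v i))) i)) = quad_form m M v"
    by (rule quad_form_cong) simp
  moreover have "quad_form m M (\<lambda>i. Im (vec_index (Matrix.vec m (\<lambda>i. complex_of_real (v i))) i)) = 0"
    by (simp add: quad_form_def)
  ultimately show ?thesis by (subst cscalar_prod_herm_mat[OF sym]) auto
qed

lemma pos_semidef_herm_mat_iff:
  assumes sym: "\<And>i j. M i j = M j i"
  shows "pos_semidef_mat (herm_mat m M) \<longleftrightarrow> psd_form m M"
proof
  assume "pos_semidef_mat (herm_mat m M)"
  then have "0 \<le> (herm_mat m M *\<^sub>v v) \<bullet>c v" if "v \<in> carrier_vec m" for v
    using that by (simp add: pos_semidef_mat_def herm_mat_def)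
  then show "psd_form m M"
    unfolding psd_form_def
    by (metis cscalar_prod_herm_mat_of_real[of M m, OF sym] zero_le_of_real_complex vec_carrier)
next
  assume "psd_form m M"
  then have "0 \<le> (herm_mat m M *\<^sub>v v) \<bullet>c v" if "v \<in> carrier_vec m" for v
    unfolding cscalar_prod_herm_mat[of M, OF sym that] zero_le_of_real_complex psd_form_def by simp
  then show "pos_semidef_mat (herm_mat m M)"
    using mat_adjoint_herm_mat[of M, OF sym] herm_mat_carrier[of m M]
    by (auto simp: pos_semidef_mat_def)
qed

lemma pos_def_herm_mat_iff:
  assumes sym: "\<And>i j. M i j = M j i"
  shows "pos_def_mat (herm_mat m M) \<longleftrightarrow> pd_form m M"
proof
  assume "pos_def_mat (herm_mat m M)"
  then have *: "0 < (herm_mat m M *\<^sub>v v) \<bullet>c v" if "v \<in> carrier_vec m" "v \<noteq> 0\<^sub>v m" for v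
    using that by (simp add: pos_def_mat_def herm_mat_def)
  show "pd_form m M"
    unfolding pd_form_def
  proof (intro allI impI)
    fix v :: "nat \<Rightarrow> real" assume "\<exists>i<m. v i \<noteq> 0"
    then obtain i where i: "i < m" "v i \<noteq> 0" by blast
    let ?v = "Matrix.vec m (\<lambda>i. complex_of_real (v i))"
    have "vec_index ?v i \<noteq> vec_index (0\<^sub>v m) i" using i by simp
    then have "?v \<noteq> 0\<^sub>v m" by metis
    from *[OF vec_carrier this] show "quad_form m M v > 0"
      unfolding cscalar_prod_herm_mat_of_real[of M, OF sym] zero_less_of_real_complex .
  qed
next
  assume pd: "pd_form m M"
  have nonneg: "quad_form m M u \<ge> 0" for u
  proof (cases "\<exists>i<m. u i \<noteq> 0")
    case True
    with pd show ?thesis by (auto simp: pd_form_def intro: less_imp_le)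
  next
    case False
    then have "quad_form m M u = quad_form m M (\<lambda>_. 0)" by (intro quad_form_cong) auto
    then show ?thesis by (simp add: quad_form_def)
  qed
  have "0 < (herm_mat m M *\<^sub>v v) \<bullet>c v" if v: "v \<in> carrier_vec m" "v \<noteq> 0\<^sub>v m" for v
  proof -
    obtain i where i: "i < m" "vec_index v i \<noteq> 0"
      using v by (metis carrier_vecD eq_vecI index_zero_vec(1,2))
    then have "Re (vec_index v i) \<noteq> 0 \<or> Im (vec_index v i) \<noteq> 0" by (auto simp: complex_eq_iff)
    then have "quad_form m M (\<lambda>i. Re (vec_index v i)) > 0 \<or> quad_form m M (\<lambda>i. Im (vec_index v i)) > 0"
      using pd i(1) by (auto simp: pd_form_def)
    then have "quad_form m M (\<lambda>i. Re (vec_index v i)) + quad_form m M (\<lambda>i. Im (vec_index v i)) > 0"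
      using nonneg by (auto intro: add_pos_nonneg add_nonneg_pos)
    then show ?thesis
      unfolding cscalar_prod_herm_mat[of M, OF sym v(1)] zero_less_of_real_complex .
  qed
  then show "pos_def_mat (herm_mat m M)"
    using mat_adjoint_herm_mat[of M, OF sym] herm_mat_carrier[of m M]
    by (auto simp: pos_def_mat_def)
qed

lemma SE_minimally_positive_herm_mat_iff:
  assumes sym: "\<And>i j. M i j = M j i" and m: "m \<ge> 1"
  shows "SE_minimally_positive (herm_mat m M) \<longleftrightarrow> se_form m M"
proof -
  define N where "N = (\<lambda>\<epsilon> i j. M i j - (if i = m - 1 \<and> j = m - 1 then \<epsilon> else 0))"
  have N: "herm_mat m M - mat_diag (dim_row (herm_mat m M))
       (\<lambda>i. if i = dim_row (herm_mat m M) - 1 then complex_of_real \<epsilon> else 0) = herm_mat m (N \<epsilon>)" for \<epsilon>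
    by (rule eq_matI) (auto simp: herm_mat_def N_def mat_diag_def)
  have q: "quad_form m (N \<epsilon>) v = quad_form m M v - \<epsilon> * (v (m - 1))\<^sup>2" for \<epsilon> v
  proof -
    have "quad_form m (\<lambda>i j. if i = m - 1 \<and> j = m - 1 then \<epsilon> else 0) v =
       (\<Sum>i<m. (\<Sum>j<m. (\<epsilon> * v i * v j) * (if j = m - 1 then 1 else 0)) * (if i = m - 1 then 1 else 0))"
      unfolding quad_form_def sum_distrib_right by (intro sum.cong refl) auto
    also have "\<dots> = \<epsilon> * (v (m - 1))\<^sup>2"
      using m by (simp only: sum_single) (simp add: sum_single power2_eq_square)
    finally have "quad_form m (\<lambda>i j. if i = m - 1 \<and> j = m - 1 then \<epsilon> else 0) v = \<epsilon> * (v (m - 1))\<^sup>2" .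
    moreover have "quad_form m (N \<epsilon>) v =
       quad_form m M v - quad_form m (\<lambda>i j. if i = m - 1 \<and> j = m - 1 then \<epsilon> else 0) v"
      unfolding quad_form_def N_def by (simp only: left_diff_distrib sum_subtractf)
    ultimately show ?thesis by simp
  qed
  have "pos_semidef_mat (herm_mat m (N \<epsilon>)) \<longleftrightarrow> psd_form m (N \<epsilon>)" for \<epsilon>
    by (rule pos_semidef_herm_mat_iff) (auto simp: N_def sym)
  then have "pos_semidef_mat (herm_mat m (N \<epsilon>)) \<longleftrightarrow> (\<forall>v. \<epsilon> * (v (m - 1))\<^sup>2 \<le> quad_form m M v)" for \<epsilon>
    by (simp add: psd_form_def q)
  then show ?thesis
    unfolding SE_minimally_positive_def se_form_def N pos_semidef_herm_mat_iff[of M, OF sym]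
    by (simp add: not_le)
qed

section \<open>Hankel forms under reduction\<close>

abbreviation hankel_entries :: "(nat \<Rightarrow> real) \<Rightarrow> nat \<Rightarrow> nat \<Rightarrow> real" where
  "hankel_entries a i j \<equiv> a (i + j + 1)"

lemma hankel_eq_herm_mat: "hankel m a = herm_mat m (hankel_entries a)"
  by (simp add: hankel_def herm_mat_def)

text \<open>Comparing coefficients in the identity
  \<open>(f z - f w) / (z - w) = F z * F w * (1 / a 1 + z * w * (g z - g w) / (z - w))\<close>, where
  \<open>f z = a 0 + z * F z\<close> and \<open>F z = 1 / (1 / a 1 - z * g z)\<close>.\<close>

lemma hankel_reduce:
  assumes a1: "a 1 \<noteq> 0"
  shows "a (Suc (i + j)) = a (Suc i) * a (Suc j) / a 1 +
    (\<Sum>p<i. \<Sum>q<j. a (i - p) * a (j - q) * reduce a (Suc (p + q)))"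
proof -
  define T where "T = (\<lambda>i j. \<Sum>p<i. \<Sum>q<j. a (i - p) * a (j - q) * reduce a (Suc (p + q)))"
  define S where "S = (\<lambda>i j. a (Suc i) * a (Suc j) / a 1 + T i j)"
  \<comment> \<open>The coefficient of order \<open>i + 1\<close> in the product of a series with
    its inverse is 0; splitting off the first two terms leaves the sum over
    \<open>reduce a\<close>.\<close>
  have G: "(\<Sum>p<i. a (i - p) * reduce a (Suc p)) = recip a 0 * a (Suc (Suc i)) + recip a 1 * a (Suc i)" for i
  proof -
    have "0 = (\<Sum>l\<le>Suc i. recip a l * a (Suc (Suc i - l)))"
      using sum_recip'[of a "Suc i"] a1 by simp
    also have "\<dots> = recip a 0 * a (Suc (Suc i)) + (\<Sum>l\<le>i. recip a (Suc l) * a (Suc (i - l)))"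
      by (simp only: sum.atMost_Suc_shift) simp
    also have "(\<Sum>l\<le>i. recip a (Suc l) * a (Suc (i - l))) =
        recip a 1 * a (Suc i) + (\<Sum>l<i. recip a (Suc (Suc l)) * a (Suc (i - Suc l)))"
      unfolding lessThan_Suc_atMost[symmetric] sum.lessThan_Suc_shift by simp
    also have "(\<Sum>l<i. recip a (Suc (Suc l)) * a (Suc (i - Suc l))) = - (\<Sum>p<i. a (i - p) * reduce a (Suc p))"
      unfolding sum_negf[symmetric] by (intro sum.cong refl) (simp add: reduce_def Suc_diff_Suc)
    finally show ?thesis by simp
  qed
  have T1: "T i (Suc j) = a (Suc j) * (\<Sum>p<i. a (i - p) * reduce a (Suc p)) +
     (\<Sum>p<i. \<Sum>q<j. a (i - p) * a (j - q) * reduce a (Suc (Suc (p + q))))" for i j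
    unfolding T_def sum.lessThan_Suc_shift by (simp add: sum.distrib sum_distrib_left mult_ac)
  have T2: "T (Suc i) j = a (Suc i) * (\<Sum>q<j. a (j - q) * reduce a (Suc q)) +
     (\<Sum>p<i. \<Sum>q<j. a (i - p) * a (j - q) * reduce a (Suc (Suc (p + q))))" for i j
    unfolding T_def sum.lessThan_Suc_shift by (simp add: sum.distrib sum_distrib_left mult_ac)
  \<comment> \<open>By \<open>G\<close> both sides become the same expression, symmetric in
    \<open>i\<close> and \<open>j\<close>. Hence \<open>S\<close> is constant along antidiagonals
    and can be read off at \<open>j = 0\<close>, where the double sum is empty.\<close>
  have step: "S i (Suc j) = S (Suc i) j" for i j
    unfolding S_def T1 T2 G recip_0 by (simp add: algebra_simps add_divide_distrib)
  have "S i j = a (Suc (i + j))"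
  proof (induction j arbitrary: i)
    case 0
    then show ?case using a1 by (simp add: S_def T_def)
  next
    case (Suc j)
    then show ?case by (simp add: step)
  qed
  then show ?thesis by (simp add: S_def T_def)
qed

text \<open>The upper triangular Toeplitz matrix of \<open>c\<close> applied to \<open>v\<close>.
  For \<open>c k = a (Suc k)\<close> it is the transpose of the matrix \<open>L\<close> of the
  overview.\<close>

definition toeplitz :: "nat \<Rightarrow> (nat \<Rightarrow> real) \<Rightarrow> (nat \<Rightarrow> real) \<Rightarrow> nat \<Rightarrow> real" where
  "toeplitz m c v p = (\<Sum>i<m. (if p \<le> i then c (i - p) else 0) * v i)"

text \<open>Triangular Toeplitz matrices multiply like truncated power series, so inverse series
  give inverse matrices.\<close>

lemma toeplitz_inverse:
  assumes conv: "\<And>k. (\<Sum>i\<le>k. c i * d (k - i)) = (if k = 0 then 1 else 0)" and p: "p < m"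
  shows "toeplitz m c (toeplitz m d v) p = v p"
proof -
  let ?c = "\<lambda>i. if p \<le> i then c (i - p) else 0"
  let ?d = "\<lambda>i q. if i \<le> q then d (q - i) else 0"
  have "toeplitz m c (toeplitz m d v) p = (\<Sum>i<m. \<Sum>q<m. ?c i * ?d i q * v q)"
    by (simp only: toeplitz_def sum_distrib_left mult.assoc)
  also have "\<dots> = (\<Sum>q<m. \<Sum>i<m. ?c i * ?d i q * v q)" by (rule sum.swap)
  also have "\<dots> = (\<Sum>q<m. v q * (if q = p then 1 else 0))"
  proof (intro sum.cong refl)
    fix q assume q: "q \<in> {..<m}"
    have "(\<Sum>i<m. ?c i * ?d i q) = (if q = p then 1 else 0)"
    proof (cases "p \<le> q")
      case True
      have "(\<Sum>i<m. ?c i * ?d i q) = (\<Sum>i\<in>{p..q}. c (i - p) * d (q - i))"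
        using q by (intro sum.mono_neutral_cong_right) auto
      also have "\<dots> = (\<Sum>i\<le>q - p. c i * d (q - p - i))"
        using True by (intro sum.reindex_bij_witness[of _ "\<lambda>i. i + p" "\<lambda>i. i - p"]) auto
      finally show ?thesis using conv[of "q - p"] True by simp
    next
      case False
      then have "(\<Sum>i<m. ?c i * ?d i q) = 0" by (intro sum.neutral) auto
      with False show ?thesis by auto
    qed
    then show "(\<Sum>i<m. ?c i * ?d i q * v q) = v q * (if q = p then 1 else 0)"
      by (simp only: sum_distrib_right[symmetric]) simp
  qed
  also have "\<dots> = v p" using p by (simp add: sum_single)
  finally show ?thesis .
qed

text \<open>Triangularity decouples the last coordinate. SE-minimality perturbs exactly this one, so
  only a scaling has to be tracked.\<close>

lemma toeplitz_last: "toeplitz (Suc m) c v m = c 0 * v m"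
proof -
  have "toeplitz (Suc m) c v m = (\<Sum>i<Suc m. (c 0 * v i) * (if i = m then 1 else 0))"
    unfolding toeplitz_def by (intro sum.cong refl) auto
  then show ?thesis by (subst (asm) sum_single) auto
qed

lemma quad_form_hankel_reduce:
  assumes a1: "a 1 \<noteq> 0"
  shows "quad_form (Suc m) (hankel_entries a) v =
    (toeplitz (Suc m) (\<lambda>k. a (Suc k)) v 0)\<^sup>2 / a 1 +
    quad_form m (hankel_entries (reduce a)) (\<lambda>p. toeplitz (Suc m) (\<lambda>k. a (Suc k)) v (Suc p))"
proof -
  \<comment> \<open>Extension by zero lets the triangular sums run over the fixed range below
    \<open>m\<close>. Column \<open>p\<close> here is column \<open>p + 1\<close> of
    \<open>L\<close>; column 0 yields the square.\<close>
  let ?L = "\<lambda>i p. if p < i then a (i - p) else 0"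
  let ?N = "\<lambda>i j. \<Sum>p<m. \<Sum>q<m. ?L i p * ?L j q * hankel_entries (reduce a) p q"
  have T: "(\<Sum>p<i. \<Sum>q<j. a (i - p) * a (j - q) * reduce a (Suc (p + q))) = ?N i j"
    if "i < Suc m" "j < Suc m" for i j
  proof -
    have "(\<Sum>q<j. a (i - p) * a (j - q) * reduce a (Suc (p + q))) =
        (\<Sum>q<m. a (i - p) * ?L j q * hankel_entries (reduce a) p q)" for p
      using that by (intro sum.mono_neutral_cong_left) auto
    then have "(\<Sum>p<i. \<Sum>q<j. a (i - p) * a (j - q) * reduce a (Suc (p + q))) =
       (\<Sum>p<i. \<Sum>q<m. a (i - p) * ?L j q * hankel_entries (reduce a) p q)" by simp
    also have "\<dots> = ?N i j"
      using that by (intro sum.mono_neutral_cong_left) (auto intro!: sum.neutral)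
    finally show ?thesis .
  qed
  have "quad_form (Suc m) (hankel_entries a) v =
     quad_form (Suc m) (\<lambda>i j. a (Suc i) * a (Suc j) / a 1 + ?N i j) v"
    unfolding quad_form_def
  proof (intro sum.cong refl)
    fix i j assume "i \<in> {..<Suc m}" "j \<in> {..<Suc m}"
    then have "hankel_entries a i j = a (Suc i) * a (Suc j) / a 1 + ?N i j"
      using hankel_reduce[of a i j, OF a1] T[of i j] by (simp del: lessThan_Suc)
    then show "hankel_entries a i j * v i * v j = (a (Suc i) * a (Suc j) / a 1 + ?N i j) * v i * v j"
      by simp
  qed
  also have "\<dots> = quad_form (Suc m) (\<lambda>i j. a (Suc i) * a (Suc j) / a 1) v + quad_form (Suc m) ?N v"
    unfolding quad_form_def by (simp only: distrib_right sum.distrib)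
  also have "quad_form (Suc m) ?N v = quad_form m (hankel_entries (reduce a)) (\<lambda>p. \<Sum>i<Suc m. ?L i p * v i)"
    by (rule quad_form_congruence)
  also have "(\<lambda>p. \<Sum>i<Suc m. ?L i p * v i) = (\<lambda>p. toeplitz (Suc m) (\<lambda>k. a (Suc k)) v (Suc p))"
    unfolding toeplitz_def by (intro ext sum.cong refl) (auto simp: Suc_diff_Suc Suc_le_eq)
  also have "quad_form (Suc m) (\<lambda>i j. a (Suc i) * a (Suc j) / a 1) v = (\<Sum>i<Suc m. a (Suc i) * v i)\<^sup>2 / a 1"
    unfolding quad_form_def power2_eq_square sum_product sum_divide_distrib
    by (intro sum.cong refl) (simp add: mult_ac)
  also have "(\<Sum>i<Suc m. a (Suc i) * v i) = toeplitz (Suc m) (\<lambda>k. a (Suc k)) v 0"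
    unfolding toeplitz_def by simp
  finally show ?thesis .
qed

lemma toeplitz_reduce:
  assumes a1: "a 1 \<noteq> 0"
  shows "p < m \<Longrightarrow> toeplitz m (\<lambda>k. a (Suc k)) (toeplitz m (recip a) v) p = v p"
    and "p < m \<Longrightarrow> toeplitz m (recip a) (toeplitz m (\<lambda>k. a (Suc k)) v) p = v p"
  using sum_recip[of a, OF a1] sum_recip'[of a, OF a1] by (auto intro!: toeplitz_inverse)

lemma exists_quad_form_hankel_reduce:
  assumes a1: "a 1 \<noteq> 0"
  shows "\<exists>v. quad_form (Suc m) (hankel_entries a) v = quad_form m (hankel_entries (reduce a)) w \<and>
    (m \<ge> 1 \<longrightarrow> w (m - 1) = a 1 * v m) \<and> ((\<exists>i<m. w i \<noteq> 0) \<longrightarrow> (\<exists>i<Suc m. v i \<noteq> 0))"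
proof -
  \<comment> \<open>A zero in coordinate 0 of the transformed vector makes the square vanish, so the
    two forms agree; \<open>v\<close> is found by inverting the transformation.\<close>
  define w' where "w' = case_nat 0 w"
  define v where "v = toeplitz (Suc m) (recip a) w'"
  have t: "toeplitz (Suc m) (\<lambda>k. a (Suc k)) v p = w' p" if "p < Suc m" for p
    unfolding v_def by (rule toeplitz_reduce(1)[of a, OF a1 that])
  have "quad_form m (hankel_entries (reduce a)) (\<lambda>p. toeplitz (Suc m) (\<lambda>k. a (Suc k)) v (Suc p)) =
      quad_form m (hankel_entries (reduce a)) w"
    by (rule quad_form_cong) (simp add: t w'_def)
  then have "quad_form (Suc m) (hankel_entries a) v = quad_form m (hankel_entries (reduce a)) w"
    using t[of 0] unfolding quad_form_hankel_reduce[of a, OF a1] by (simp add: w'_def)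
  moreover have "w (m - 1) = a 1 * v m" if "m \<ge> 1"
    using t[of m] that unfolding toeplitz_last by (cases m) (auto simp: w'_def)
  moreover have "\<exists>i<Suc m. v i \<noteq> 0" if "\<exists>i<m. w i \<noteq> 0"
  proof (rule ccontr)
    assume *: "\<not> (\<exists>i<Suc m. v i \<noteq> 0)"
    have "w i = 0" if "i < m" for i
    proof -
      have "w i = toeplitz (Suc m) (\<lambda>k. a (Suc k)) v (Suc i)"
        using t[of "Suc i"] that by (simp add: w'_def)
      also have "\<dots> = 0" unfolding toeplitz_def using * by (intro sum.neutral) auto
      finally show ?thesis .
    qed
    with that show False by auto
  qed
  ultimately show ?thesis by blast
qed

lemma psd_form_hankel_Suc:
  assumes a1: "a 1 > 0"
  shows "psd_form (Suc m) (hankel_entries a) \<longleftrightarrow> psd_form m (hankel_entries (reduce a))"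
proof
  assume "psd_form (Suc m) (hankel_entries a)"
  then show "psd_form m (hankel_entries (reduce a))"
    unfolding psd_form_def
  proof (intro allI)
    fix w :: "nat \<Rightarrow> real"
    assume *: "\<forall>v. 0 \<le> quad_form (Suc m) (hankel_entries a) v"
    obtain v where "quad_form (Suc m) (hankel_entries a) v = quad_form m (hankel_entries (reduce a)) w"
      using exists_quad_form_hankel_reduce[of a m w] less_imp_neq[OF a1] by metis
    with * show "0 \<le> quad_form m (hankel_entries (reduce a)) w" by metis
  qed
next
  assume "psd_form m (hankel_entries (reduce a))"
  then show "psd_form (Suc m) (hankel_entries a)"
    unfolding psd_form_def using quad_form_hankel_reduce[of a m] a1 by simp
qed

lemma pd_form_hankel_Suc:
  "pd_form (Suc m) (hankel_entries a) \<longleftrightarrow> a 1 > 0 \<and> pd_form m (hankel_entries (reduce a))"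
proof (cases "a 1 > 0")
  case a1: True
  have "pd_form m (hankel_entries (reduce a))" if "pd_form (Suc m) (hankel_entries a)"
    unfolding pd_form_def
  proof (intro allI impI)
    fix w :: "nat \<Rightarrow> real" assume w: "\<exists>i<m. w i \<noteq> 0"
    obtain v where "quad_form (Suc m) (hankel_entries a) v = quad_form m (hankel_entries (reduce a)) w"
        "(\<exists>i<m. w i \<noteq> 0) \<Longrightarrow> (\<exists>i<Suc m. v i \<noteq> 0)"
      using exists_quad_form_hankel_reduce[of a m w] less_imp_neq[OF a1] by metis
    then show "quad_form m (hankel_entries (reduce a)) w > 0"
      using that w unfolding pd_form_def by metis
  qed
  moreover have "pd_form (Suc m) (hankel_entries a)" if pd: "pd_form m (hankel_entries (reduce a))"
    unfolding pd_form_def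
  proof (intro allI impI)
    fix v :: "nat \<Rightarrow> real" assume v: "\<exists>i<Suc m. v i \<noteq> 0"
    let ?t = "toeplitz (Suc m) (\<lambda>k. a (Suc k)) v"
    show "quad_form (Suc m) (hankel_entries a) v > 0"
    proof (cases "\<exists>i<m. ?t (Suc i) \<noteq> 0")
      case True
      then have "quad_form m (hankel_entries (reduce a)) (\<lambda>p. ?t (Suc p)) > 0"
        using pd[unfolded pd_form_def, THEN spec, of "\<lambda>p. ?t (Suc p)"] by (rule rev_mp)
      moreover have "(?t 0)\<^sup>2 / a 1 \<ge> 0" using a1 by simp
      ultimately show ?thesis using quad_form_hankel_reduce[of a m v] a1 by linarith
    next
      case False
      have "?t 0 \<noteq> 0"
      proof
        assume 0: "?t 0 = 0"
        have "?t i = 0" if "i < Suc m" for i using that False 0 by (cases i) auto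
        then have "toeplitz (Suc m) (recip a) ?t i = 0" for i
          unfolding toeplitz_def[of _ "recip a"] by (intro sum.neutral) auto
        then have "v i = 0" if "i < Suc m" for i
          using toeplitz_reduce(2)[of a i "Suc m" v] that a1 by simp
        with v show False by blast
      qed
      moreover have "quad_form m (hankel_entries (reduce a)) (\<lambda>p. ?t (Suc p)) =
          quad_form m (hankel_entries (reduce a)) (\<lambda>p. 0)"
        using False by (intro quad_form_cong) auto
      ultimately show ?thesis
        using quad_form_hankel_reduce[of a m v] a1 by (simp add: quad_form_def)
    qed
  qed
  ultimately show ?thesis using a1 by blast
next
  case False
  have "\<not> pd_form (Suc m) (hankel_entries a)"
  proof
    assume "pd_form (Suc m) (hankel_entries a)"
    then have "quad_form (Suc m) (hankel_entries a) (\<lambda>k. if k = 0 then 1 else 0) > 0"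
      unfolding pd_form_def by auto
    with False show False by (simp add: quad_form_single)
  qed
  with False show ?thesis by blast
qed

text \<open>The last coordinates differ by the factor \<open>a 1\<close>, so a violation for one
  \<open>\<epsilon>\<close> becomes a violation for a rescaled one. At size 1 the positive entry
  \<open>a 1\<close> can itself be subtracted, so minimality fails there.\<close>

lemma se_form_hankel_Suc:
  assumes a1: "a 1 > 0"
  shows "se_form (Suc m) (hankel_entries a) \<longleftrightarrow> m \<ge> 1 \<and> se_form m (hankel_entries (reduce a))"
proof (cases "m \<ge> 1")
  case m: True
  have "\<exists>w. quad_form m (hankel_entries (reduce a)) w < \<epsilon> * (w (m - 1))\<^sup>2"
    if se: "\<forall>\<epsilon>>0. \<exists>v. quad_form (Suc m) (hankel_entries a) v < \<epsilon> * (v m)\<^sup>2" and "\<epsilon> > 0" for \<epsilon>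
  proof -
    have "\<epsilon> * (a 1)\<^sup>2 > 0" using a1 \<open>\<epsilon> > 0\<close> by simp
    with se obtain v where v: "quad_form (Suc m) (hankel_entries a) v < \<epsilon> * (a 1)\<^sup>2 * (v m)\<^sup>2" by blast
    let ?t = "toeplitz (Suc m) (\<lambda>k. a (Suc k)) v"
    have "(?t 0)\<^sup>2 / a 1 \<ge> 0" using a1 by simp
    then have "quad_form m (hankel_entries (reduce a)) (\<lambda>p. ?t (Suc p)) < \<epsilon> * (a 1)\<^sup>2 * (v m)\<^sup>2"
      using quad_form_hankel_reduce[of a m v] a1 v by linarith
    also have "\<dots> = \<epsilon> * (?t (Suc (m - 1)))\<^sup>2"
      using m by (simp add: toeplitz_last power_mult_distrib)
    finally show ?thesis by blast
  qed
  moreover have "\<exists>v. quad_form (Suc m) (hankel_entries a) v < \<epsilon> * (v m)\<^sup>2"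
    if se: "\<forall>\<epsilon>>0. \<exists>w. quad_form m (hankel_entries (reduce a)) w < \<epsilon> * (w (m - 1))\<^sup>2" and "\<epsilon> > 0" for \<epsilon>
  proof -
    have "\<epsilon> / (a 1)\<^sup>2 > 0" using a1 \<open>\<epsilon> > 0\<close> by simp
    with se obtain w where w: "quad_form m (hankel_entries (reduce a)) w < \<epsilon> / (a 1)\<^sup>2 * (w (m - 1))\<^sup>2" by blast
    obtain v where v: "quad_form (Suc m) (hankel_entries a) v = quad_form m (hankel_entries (reduce a)) w"
        "m \<ge> 1 \<Longrightarrow> w (m - 1) = a 1 * v m"
      using exists_quad_form_hankel_reduce[of a m w] less_imp_neq[OF a1] by metis
    have "quad_form (Suc m) (hankel_entries a) v < \<epsilon> * (v m)\<^sup>2"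
      unfolding v(1) using w a1 v(2)[OF m] by (simp add: power_mult_distrib)
    then show ?thesis by blast
  qed
  ultimately show ?thesis
    unfolding se_form_def psd_form_hankel_Suc[of a, OF a1] using m by auto
next
  case False
  have "\<not> se_form (Suc m) (hankel_entries a)"
  proof
    assume "se_form (Suc m) (hankel_entries a)"
    then obtain v where "quad_form (Suc m) (hankel_entries a) v < a 1 * (v m)\<^sup>2"
      using a1 by (auto simp: se_form_def)
    moreover have "m = 0" using False by simp
    ultimately show False by (simp add: quad_form_def power2_eq_square)
  qed
  with False show ?thesis by simp
qed

text \<open>A zero diagonal entry kills its row, and column \<open>i + 2\<close> of row
  \<open>i\<close> holds the value of the next diagonal entry, so zeros spread down the diagonal.
  The corner is not reached: it would need column \<open>m\<close>.\<close>

lemma psd_hankel_zero: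
  assumes psd: "psd_form m (hankel_entries a)" and a1: "a 1 = 0" and k: "1 \<le> k" "k \<le> 2 * m - 2"
  shows "a k = 0"
proof -
  have odd: "a (2 * i + 1) = 0" if "i + 2 \<le> m" for i
    using that
  proof (induction i)
    case (Suc i)
    have "hankel_entries a i (i + 2) = 0"
      by (rule psd_form_zero_row[OF psd, of i "i + 2"]) (use Suc in \<open>auto simp: add_ac mult_2\<close>)
    then show ?case by (simp add: mult_2)
  qed (use a1 in simp)
  show ?thesis
  proof (cases "odd k")
    case True
    then obtain i where "k = 2 * i + 1" by (elim oddE)
    with odd[of i] k show ?thesis by simp
  next
    case False
    then obtain i where i: "k = 2 * i" by auto
    have "hankel_entries a (i - 1) i = 0"
      by (rule psd_form_zero_row[OF psd, of "i - 1" i])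
        (use i k odd[of "i - 1"] in \<open>auto simp: add_ac mult_2\<close>)
    with i k show ?thesis by (simp add: mult_2)
  qed
qed

text \<open>Only the corner \<open>a (2 * m - 1)\<close> can survive positivity. The form is then
  the corner times the square of the last coordinate, and minimality with \<open>\<epsilon>\<close>
  equal to the corner excludes a positive value.\<close>

lemma se_form_hankel_zero_iff:
  assumes m: "m \<ge> 1" and a1: "a 1 = 0"
  shows "se_form m (hankel_entries a) \<longleftrightarrow> (\<forall>k\<in>{1..2*m-1}. a k = 0)"
proof
  assume se: "se_form m (hankel_entries a)"
  then have psd: "psd_form m (hankel_entries a)" by (simp add: se_form_def)
  let ?l = "a (2 * m - 1)"
  have l0: "?l \<ge> 0"
  proof -
    have "m - 1 + (m - 1) + 1 = 2 * m - 1" using m by simp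
    then show ?thesis using psd_form_diag[OF psd, of "m - 1"] m by simp
  qed
  have z: "a k = 0" if "1 \<le> k" "k \<le> 2 * m - 2" for k
    using psd_hankel_zero[OF psd a1 that] .
  have q: "quad_form m (hankel_entries a) v = ?l * (v (m - 1))\<^sup>2" for v
  proof -
    have "quad_form m (hankel_entries a) v =
        (\<Sum>i<m. (\<Sum>j<m. (?l * v i * v j) * (if j = m - 1 then 1 else 0)) * (if i = m - 1 then 1 else 0))"
      unfolding quad_form_def sum_distrib_right
    proof (intro sum.cong refl)
      fix i j assume ij: "i \<in> {..<m}" "j \<in> {..<m}"
      show "hankel_entries a i j * v i * v j =
         ?l * v i * v j * (if j = m - 1 then 1 else 0) * (if i = m - 1 then 1 else 0)"
      proof (cases "i = m - 1 \<and> j = m - 1")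
        case True
        then have "i + j + 1 = 2 * m - 1" using m by auto
        then have "hankel_entries a i j = ?l" by (rule arg_cong)
        with True show ?thesis by simp
      next
        case False
        then have "i + j + 1 \<le> 2 * m - 2" using ij by auto
        then have "hankel_entries a i j = 0" by (intro z) auto
        with False show ?thesis by auto
      qed
    qed
    then show ?thesis using m by (simp only: sum_single) (simp add: sum_single power2_eq_square)
  qed
  have "?l \<le> 0"
  proof (rule ccontr)
    assume "\<not> ?l \<le> 0"
    with se obtain v where "quad_form m (hankel_entries a) v < ?l * (v (m - 1))\<^sup>2"
      unfolding se_form_def by (meson not_le)
    with q show False by simp
  qed
  with l0 have l: "?l = 0" by simp
  show "\<forall>k\<in>{1..2*m-1}. a k = 0"
  proof
    fix k assume k: "k \<in> {1..2 * m - 1}"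
    then consider "k = 2 * m - 1" | "k \<le> 2 * m - 2" by fastforce
    then show "a k = 0" by cases (use l z k in auto)
  qed
next
  assume z: "\<forall>k\<in>{1..2*m-1}. a k = 0"
  have q: "quad_form m (hankel_entries a) v = 0" for v
    unfolding quad_form_def using z by (intro sum.neutral ballI) auto
  have "\<exists>v. 0 < \<epsilon> * (v (m - 1))\<^sup>2" if "\<epsilon> > 0" for \<epsilon> :: real
    using that by (intro exI[of _ "\<lambda>_. 1"]) simp
  then show "se_form m (hankel_entries a)" unfolding se_form_def psd_form_def q by simp
qed

text \<open>The two ways in which repeated reduction can succeed: all leading coefficients are positive,
  or after \<open>r\<close> steps the remaining data are those of a constant function.\<close>

inductive hankel_pd :: "nat \<Rightarrow> (nat \<Rightarrow> real) \<Rightarrow> bool" where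
  base: "a 1 > 0 \<Longrightarrow> hankel_pd 1 a"
| step: "a 1 > 0 \<Longrightarrow> hankel_pd m (reduce a) \<Longrightarrow> hankel_pd (Suc m) a"

inductive hankel_se :: "nat \<Rightarrow> nat \<Rightarrow> (nat \<Rightarrow> real) \<Rightarrow> bool" where
  base: "m \<ge> 1 \<Longrightarrow> (\<And>k. k \<in> {1..2*m-1} \<Longrightarrow> a k = 0) \<Longrightarrow> hankel_se m 0 a"
| step: "a 1 > 0 \<Longrightarrow> hankel_se m r (reduce a) \<Longrightarrow> hankel_se (Suc m) (Suc r) a"

lemma hankel_pd_ge_1: "hankel_pd m a \<Longrightarrow> m \<ge> 1"
  by (induction rule: hankel_pd.induct) auto

lemma hankel_se_bounds: "hankel_se m r a \<Longrightarrow> r < m"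
  by (induction rule: hankel_se.induct) auto

lemma pd_form_hankel_iff: "m \<ge> 1 \<Longrightarrow> pd_form m (hankel_entries a) \<longleftrightarrow> hankel_pd m a"
proof (induction m arbitrary: a)
  case (Suc m)
  show ?case
  proof (cases "m = 0")
    case True
    \<comment> \<open>The reduced form has size 0 and is vacuously definite, whereas a
      \<open>hankel_pd\<close> chain ends at size 1.\<close>
    have "pd_form 0 (hankel_entries (reduce a))" by (simp add: pd_form_def)
    with True show ?thesis unfolding pd_form_hankel_Suc
      by (auto intro: hankel_pd.base[unfolded One_nat_def] elim: hankel_pd.cases)
  next
    case False
    with Suc.IH[of "reduce a"] show ?thesis unfolding pd_form_hankel_Suc
      by (auto intro: hankel_pd.step elim: hankel_pd.cases)
  qed
qed simp

lemma se_form_hankel_iff: "m \<ge> 1 \<Longrightarrow> se_form m (hankel_entries a) \<longleftrightarrow> (\<exists>r. hankel_se m r a)"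
proof (induction m arbitrary: a)
  case (Suc m)
  \<comment> \<open>A negative \<open>a 1\<close> refutes both sides, zero ends the chain at once,
    and a positive value passes the question to the reduced data.\<close>
  consider "a 1 < 0" | "a 1 = 0" | "a 1 > 0" by linarith
  then show ?case
  proof cases
    case 1
    have "\<not> se_form (Suc m) (hankel_entries a)"
      using psd_form_diag[of "Suc m" "hankel_entries a" 0] 1 by (auto simp: se_form_def)
    moreover have "\<not> hankel_se (Suc m) r a" for r
      using 1 by (auto elim: hankel_se.cases)
    ultimately show ?thesis by blast
  next
    case 2
    have "(\<exists>r. hankel_se (Suc m) r a) \<longleftrightarrow> (\<forall>k\<in>{1..2*Suc m-1}. a k = 0)"
    proof
      assume "\<forall>k\<in>{1..2*Suc m-1}. a k = 0"
      then have "hankel_se (Suc m) 0 a" by (intro hankel_se.base) auto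
      then show "\<exists>r. hankel_se (Suc m) r a" ..
    qed (use 2 in \<open>auto elim: hankel_se.cases\<close>)
    with 2 show ?thesis using se_form_hankel_zero_iff[of "Suc m" a] by simp
  next
    case 3
    have "(\<exists>r. hankel_se (Suc m) r a) \<longleftrightarrow> (\<exists>r. hankel_se m r (reduce a))"
    proof
      assume "\<exists>r. hankel_se (Suc m) r a"
      then obtain r where "hankel_se (Suc m) r a" ..
      then show "\<exists>r. hankel_se m r (reduce a)"
        by cases (use 3 in auto)
    next
      assume "\<exists>r. hankel_se m r (reduce a)"
      with 3 show "\<exists>r. hankel_se (Suc m) r a" by (blast intro: hankel_se.step)
    qed
    with 3 show ?thesis
      unfolding se_form_hankel_Suc[of a, OF 3] using Suc.IH hankel_se_bounds by fastforce
  qed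
qed simp

lemma pos_def_hankel_iff: "m \<ge> 1 \<Longrightarrow> pos_def_mat (hankel m a) \<longleftrightarrow> hankel_pd m a"
  unfolding hankel_eq_herm_mat by (subst pos_def_herm_mat_iff) (simp_all add: add.commute pd_form_hankel_iff[simplified])

lemma SE_minimally_positive_hankel_iff:
  "m \<ge> 1 \<Longrightarrow> SE_minimally_positive (hankel m a) \<longleftrightarrow> (\<exists>r. hankel_se m r a)"
  unfolding hankel_eq_herm_mat
  by (subst SE_minimally_positive_herm_mat_iff) (simp_all add: add.commute se_form_hankel_iff[simplified])

section \<open>Rank of an SE-minimal Hankel matrix\<close>

lemma rank_le_sum_of_products:
  fixes A :: "'a::field mat"
  assumes "A \<in> carrier_mat n n"
    and "\<And>i j. i < n \<Longrightarrow> j < n \<Longrightarrow> A $$ (i, j) = (\<Sum>k<r. f k i * g k j)"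
  shows "vec_space.rank n A \<le> r"
  using assms
proof (induction r arbitrary: A)
  case 0
  then have "A = 0\<^sub>m n n" by (intro eq_matI) auto
  then show ?case by (simp add: vec_space.rank_0I)
next
  case (Suc r)
  define B where "B = Matrix.mat n n (\<lambda>(i, j). \<Sum>k<r. f k i * g k j)"
  define C where "C = Matrix.mat n n (\<lambda>(i, j). f r i * g r j)"
  have "A = B + C" using Suc.prems by (intro eq_matI) (auto simp: B_def C_def)
  then have "vec_space.rank n A \<le> vec_space.rank n B + vec_space.rank n C"
    by (simp only:) (rule vec_space.rank_subadditive, auto simp: B_def C_def)
  also have "vec_space.rank n B \<le> r" by (rule Suc.IH) (auto simp: B_def)
  also have "vec_space.rank n C \<le> 1"
    by (rule vec_space.rank_le_1_product_entries[where f = "f r" and g = "g r"]) (auto simp: C_def)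
  finally show ?case by simp
qed

text \<open>Each reduction contributes one rank-one term, and nothing remains at the end of the
  chain because the final data vanish.\<close>

lemma hankel_se_rank_decomposition:
  "hankel_se m r a \<Longrightarrow> \<exists>f g. \<forall>i<m. \<forall>j<m. hankel_entries a i j = (\<Sum>k<r. f k i * g k j)"
proof (induction rule: hankel_se.induct)
  case (base m a)
  then show ?case by auto
next
  case (step a m r)
  then obtain f g where fg: "\<And>i j. i < m \<Longrightarrow> j < m \<Longrightarrow> reduce a (i + j + 1) = (\<Sum>k<r. f k i * g k j)"
    by blast
  \<comment> \<open>Index 0 carries the new product \<open>a (Suc i) * a (Suc j) / a 1\<close>; the
    old factors, shifted by one, are multiplied by the triangular matrix of
    \<open>hankel_reduce\<close>.\<close>
  let ?f = "case_nat (\<lambda>i. a (Suc i) / a 1) (\<lambda>k i. \<Sum>p<i. a (i - p) * f k p)"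
  let ?g = "case_nat (\<lambda>j. a (Suc j)) (\<lambda>k j. \<Sum>q<j. a (j - q) * g k q)"
  have "hankel_entries a i j = (\<Sum>k<Suc r. ?f k i * ?g k j)" if ij: "i < Suc m" "j < Suc m" for i j
  proof -
    have "(\<Sum>p<i. \<Sum>q<j. a (i - p) * a (j - q) * reduce a (Suc (p + q))) =
        (\<Sum>p<i. \<Sum>q<j. \<Sum>k<r. a (i - p) * f k p * (a (j - q) * g k q))"
      using ij fg by (intro sum.cong refl) (simp add: sum_distrib_left mult_ac)
    also have "\<dots> = (\<Sum>p<i. \<Sum>k<r. \<Sum>q<j. a (i - p) * f k p * (a (j - q) * g k q))"
      by (intro sum.cong refl sum.swap)
    also have "\<dots> = (\<Sum>k<r. \<Sum>p<i. \<Sum>q<j. a (i - p) * f k p * (a (j - q) * g k q))"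
      by (rule sum.swap)
    finally show ?thesis
      unfolding sum.lessThan_Suc_shift using hankel_reduce[of a i j] \<open>a 1 > 0\<close>
      by (simp add: sum_product)
  qed
  then show ?case by blast
qed

lemma pick_lessThan: "i < r \<Longrightarrow> pick {..<r} i = i"
proof (induction i)
  case 0
  then show ?case by (auto intro!: Least_equality)
next
  case (Suc i)
  then show ?case by (auto intro!: Least_equality)
qed

text \<open>The first \<open>r\<close> leading coefficients of the chain are positive, and
  definiteness of the leading block of size \<open>r\<close> asks for no more.\<close>

lemma hankel_se_imp_hankel_pd: "hankel_se m r a \<Longrightarrow> r \<ge> 1 \<Longrightarrow> hankel_pd r a"
proof (induction rule: hankel_se.induct)
  case (step a m r)
  then show ?case
    by (cases "r = 0") (auto intro: hankel_pd.step hankel_pd.base[unfolded One_nat_def])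
qed simp

text \<open>The rank-one terms bound the rank from above. From below, the leading minor of size
  \<open>r\<close> is nonzero because a definite matrix has no kernel.\<close>

lemma rank_hankel:
  assumes "hankel_se m r a"
  shows "vec_space.rank m (hankel m a) = r"
proof (rule antisym)
  obtain f g where fg: "\<And>i j. i < m \<Longrightarrow> j < m \<Longrightarrow> hankel_entries a i j = (\<Sum>k<r. f k i * g k j)"
    using hankel_se_rank_decomposition[OF assms] by blast
  show "vec_space.rank m (hankel m a) \<le> r"
    by (rule rank_le_sum_of_products[where f = "\<lambda>k i. of_real (f k i)" and g = "\<lambda>k i. of_real (g k i)"])
      (auto simp: hankel_def fg[simplified])
  show "r \<le> vec_space.rank m (hankel m a)"
  proof (cases "r = 0")
    case False
    have rm: "r < m" using hankel_se_bounds[OF assms] .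
    then have card: "card {i. i < m \<and> i \<in> {..<r}} = r"
      by (subst Collect_cong[of _ "\<lambda>i. i < r"]) auto
    have sub: "submatrix (hankel m a) {..<r} {..<r} = hankel r a"
      by (rule eq_matI) (use rm card in \<open>auto simp: submatrix_def hankel_def pick_lessThan\<close>)
    have pd: "pos_def_mat (hankel r a)"
      using pos_def_hankel_iff hankel_se_imp_hankel_pd[OF assms] False by simp
    have "det (hankel r a) \<noteq> 0"
    proof
      assume "det (hankel r a) = 0"
      then obtain v where v: "v \<in> carrier_vec r" "v \<noteq> 0\<^sub>v r" "hankel r a *\<^sub>v v = 0\<^sub>v r"
        using det_0_iff_vec_prod_zero[of "hankel r a" r] by (auto simp: hankel_def)
      then have "0 < (hankel r a *\<^sub>v v) \<bullet>c v"
        using pd by (auto simp: pos_def_mat_def hankel_def)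
      with v show False by simp
    qed
    then have "card {j. j < m \<and> j \<in> {..<r}} \<le> vec_space.rank m (hankel m a)"
      unfolding sub[symmetric] by (rule vec_space.rank_gt_minor[rotated]) (simp add: hankel_def)
    then show ?thesis unfolding card .
  qed simp
qed

subsection \<open>The kinds of solution\<close>

lemma isCont_higher_deriv:
  fixes g :: "complex \<Rightarrow> complex"
  assumes "open U" "x \<in> U" "g holomorphic_on U"
  shows "isCont ((deriv ^^ k) g) x"
proof -
  have "continuous_on U ((deriv ^^ k) g)"
    by (intro holomorphic_on_imp_continuous_on holomorphic_higher_deriv assms)
  then show ?thesis using assms by (simp add: continuous_on_eq_continuous_at)
qed

text \<open>Taylor's formula with Peano remainder: continuity of all derivatives at \<open>x\<close>
  is fed into \<open>expands_if_derivs_tendsto\<close> on a ball.\<close>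

lemma expands_holomorphic:
  assumes "open U" "x \<in> U" "g holomorphic_on U"
  shows "expands (at x) x n (\<lambda>k. (deriv ^^ k) g x / fact k) g"
proof -
  obtain r where r: "r > 0" "ball x r \<subseteq> U" using assms by (meson openE)
  have at: "at x within ball x r = at x" using r by (intro at_within_open) auto
  have "expands (at x within ball x r) x n (\<lambda>k. (deriv ^^ k) g x / fact k) g"
  proof (rule expands_if_derivs_tendsto[where S = U])
    fix z :: complex and t :: real
    assume z: "z \<in> ball x r" and t: "0 < t" "t \<le> 1"
    have "t * cmod (z - x) \<le> 1 * cmod (z - x)" using t by (intro mult_right_mono) auto
    also have "\<dots> < r" using z by (simp add: dist_norm norm_minus_commute)
    finally show "x + of_real t * (z - x) \<in> ball x r" using t by (simp add: dist_norm norm_mult)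
  next
    fix k
    show "((\<lambda>z. (deriv ^^ k) g z / fact k) \<longlongrightarrow> (deriv ^^ k) g x / fact k) (at x within ball x r)"
      unfolding at using isCont_higher_deriv[OF assms, of k] by (intro tendsto_intros) (auto simp: isCont_def)
  qed (use assms r in auto)
  then show ?thesis unfolding at .
qed

text \<open>Expansions, unlike higher derivatives, can be carried through \<open>augment\<close> by
  the coefficient calculus; \<open>expands_unique\<close> gives the derivatives back.\<close>

lemma analytic_solution_iff_expands:
  "analytic_solution x n a f \<longleftrightarrow>
     f \<in> pick_class \<and>
     (\<exists>g U. open U \<and> of_real x \<in> U \<and> g holomorphic_on U \<and>
        (\<forall>z \<in> U \<inter> upper_half_plane. g z = f z) \<and>
        expands (at (of_real x)) (of_real x) n (\<lambda>k. of_real (a k)) g)"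
proof -
  have "expands (at (of_real x)) (of_real x) n (\<lambda>k. of_real (a k)) g \<longleftrightarrow>
      (\<forall>k\<le>n. (deriv ^^ k) g (of_real x) / fact k = of_real (a k))"
    if "open U" "of_real x \<in> U" "g holomorphic_on U" for g U
  proof
    assume "expands (at (of_real x)) (of_real x) n (\<lambda>k. of_real (a k)) g"
    then show "\<forall>k\<le>n. (deriv ^^ k) g (of_real x) / fact k = of_real (a k)"
      using expands_unique[OF order_refl at_neq_bot expands_holomorphic[OF that]] by blast
  next
    assume "\<forall>k\<le>n. (deriv ^^ k) g (of_real x) / fact k = of_real (a k)"
    then show "expands (at (of_real x)) (of_real x) n (\<lambda>k. of_real (a k)) g"
      using expands_holomorphic[OF that, of n] by (subst (asm) expands_cong) auto
  qed
  then show ?thesis unfolding analytic_solution_def by metis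
qed

lemma weak_solution_iff_expands:
  "weak_solution x n a f \<longleftrightarrow> f \<in> pick_class \<and>
     (\<forall>S. nt_approach_set x S \<longrightarrow>
        expands (at (of_real x) within S) (of_real x) n (\<lambda>k. of_real (a k)) f)"
  by (simp add: weak_solution_def nt_small_o_def nt_tendsto_def expands_def)

lemma nt_approach_set_ray: "nt_approach_set x (ray x)"
  unfolding nt_approach_set_def
proof (intro conjI)
  show "of_real x \<in> closure (ray x)"
    using at_within_ray_neq_bot[of x] by (auto simp: closure_def trivial_limit_within)
  have "cmod (z - of_real x) / Im z \<le> 1" if "z \<in> ray x" for z
  proof -
    have "z - of_real x = \<i> * of_real (Im z)" using that by (simp add: ray_def complex_eq_iff)
    then have "cmod (z - of_real x) = Im z" using that by (simp add: norm_mult ray_def)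
    then show ?thesis using that by (simp add: ray_def)
  qed
  then show "bounded ((\<lambda>z. cmod (z - of_real x) / Im z) ` ray x)"
    unfolding bounded_iff by (intro exI[of _ 1]) (auto simp: ray_def)
qed (rule ray_subset_upper_half_plane)

lemma eventually_nt_approach_set:
  assumes "nt_approach_set x S" "open U" "of_real x \<in> U"
  shows "eventually (\<lambda>z. z \<in> U \<inter> upper_half_plane) (at (of_real x) within S)"
  using assms eventually_nhds_in_open[of U "of_real x"]
  by (auto simp: eventually_at_filter nt_approach_set_def elim!: eventually_mono)

lemma analytic_imp_weak_solution:
  assumes "analytic_solution x n a f"
  shows "weak_solution x n a f"
  unfolding weak_solution_iff_expands
proof (intro conjI allI impI)
  obtain g U where g: "open U" "of_real x \<in> U" "\<And>z. z \<in> U \<inter> upper_half_plane \<Longrightarrow> g z = f z"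
      "expands (at (of_real x)) (of_real x) n (\<lambda>k. of_real (a k)) g"
    using assms unfolding analytic_solution_iff_expands by metis
  fix S assume S: "nt_approach_set x S"
  have "expands (at (of_real x) within S) (of_real x) n (\<lambda>k. of_real (a k)) g"
    by (rule expands_mono[OF g(4)]) (rule at_le, simp)
  then show "expands (at (of_real x) within S) (of_real x) n (\<lambda>k. of_real (a k)) f"
    by (rule iffD1[OF expands_cong, rotated -1])
      (use eventually_nt_approach_set[OF S g(1,2)] g(3) in \<open>auto elim!: eventually_mono\<close>)
qed (use assms in \<open>simp add: analytic_solution_def\<close>)

lemma analytic_imp_nontangential_solution:
  assumes "analytic_solution x n a f"
  shows "nontangential_solution x n a f"
  unfolding nontangential_solution_def nt_tendsto_def
proof (intro conjI allI impI)
  obtain g U where g: "open U" "of_real x \<in> U" "g holomorphic_on U"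
      "\<And>z. z \<in> U \<inter> upper_half_plane \<Longrightarrow> g z = f z"
      "\<And>k. k \<le> n \<Longrightarrow> (deriv ^^ k) g (of_real x) / fact k = of_real (a k)"
    using assms unfolding analytic_solution_def by metis
  have f: "f holomorphic_on upper_half_plane"
    using assms by (simp add: analytic_solution_def pick_class_def)
  fix S k assume S: "nt_approach_set x S" and k: "k \<le> n"
  have "((deriv ^^ k) g \<longlongrightarrow> (deriv ^^ k) g (of_real x)) (at (of_real x) within S)"
    using isCont_higher_deriv[OF g(1-3), of k] by (auto simp: isCont_def intro: tendsto_within_subset)
  then have "((\<lambda>z. (deriv ^^ k) g z / fact k) \<longlongrightarrow> (deriv ^^ k) g (of_real x) / fact k) (at (of_real x) within S)"
    by (rule tendsto_divide[OF _ tendsto_const]) simp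
  then have "((\<lambda>z. (deriv ^^ k) g z / fact k) \<longlongrightarrow> of_real (a k)) (at (of_real x) within S)"
    by (simp only: g(5)[OF k])
  moreover have "\<forall>\<^sub>F z in at (of_real x) within S. (deriv ^^ k) g z / fact k = (deriv ^^ k) f z / fact k"
    using eventually_nt_approach_set[OF S g(1,2)]
  proof eventually_elim
    case (elim z)
    have "(deriv ^^ k) g z = (deriv ^^ k) f z"
      by (rule higher_deriv_transform_within_open[where S = "U \<inter> upper_half_plane"])
        (use elim g(1,4) open_upper_half_plane holomorphic_on_subset[OF g(3)] holomorphic_on_subset[OF f]
          in \<open>simp_all add: open_Int\<close>)
    then show ?case by simp
  qed
  ultimately show "((\<lambda>z. (deriv ^^ k) f z / fact k) \<longlongrightarrow> of_real (a k)) (at (of_real x) within S)"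
    by (rule Lim_transform_eventually)
qed (use assms in \<open>simp add: analytic_solution_def\<close>)

lemma nontangential_imp_radial_solution:
  assumes "nontangential_solution x n a f"
  shows "radial_solution x n a f"
  unfolding radial_solution_def
proof (intro conjI allI impI)
  fix k assume "k \<le> n"
  with assms nt_approach_set_ray[of x]
  have "((\<lambda>z. (deriv ^^ k) f z / fact k) \<longlongrightarrow> of_real (a k)) (at (of_real x) within ray x)"
    unfolding nontangential_solution_def nt_tendsto_def by blast
  then show "((\<lambda>y. (deriv ^^ k) f (Complex x y) / fact k) \<longlongrightarrow> of_real (a k)) (at_right 0)"
    unfolding tendsto_ray_iff .
qed (use assms in \<open>simp add: nontangential_solution_def\<close>)

definition ray_solution :: "real \<Rightarrow> nat \<Rightarrow> (nat \<Rightarrow> real) \<Rightarrow> (complex \<Rightarrow> complex) \<Rightarrow> bool" where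
  "ray_solution x n a f \<longleftrightarrow>
     f \<in> pick_class \<and> expands (at (of_real x) within ray x) (of_real x) n (\<lambda>k. of_real (a k)) f"

lemma weak_imp_ray_solution: "weak_solution x n a f \<Longrightarrow> ray_solution x n a f"
  using nt_approach_set_ray by (simp add: weak_solution_iff_expands ray_solution_def)

lemma radial_imp_ray_solution:
  assumes "radial_solution x n a f"
  shows "ray_solution x n a f"
  unfolding ray_solution_def
proof
  show "expands (at (of_real x) within ray x) (of_real x) n (\<lambda>k. of_real (a k)) f"
  proof (rule expands_if_derivs_tendsto[OF open_upper_half_plane _ ray_subset_upper_half_plane])
    show "f holomorphic_on upper_half_plane"
      using assms by (simp add: radial_solution_def pick_class_def)
    show "of_real x + of_real t * (z - of_real x) \<in> ray x" if "z \<in> ray x" "0 < t" "t \<le> 1" for z t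
      using that by (simp add: ray_def)
    show "((\<lambda>z. (deriv ^^ k) f z / fact k) \<longlongrightarrow> of_real (a k)) (at (of_real x) within ray x)"
      if "k \<le> n" for k
      using assms that unfolding tendsto_ray_iff radial_solution_def by blast
  qed
qed (use assms in \<open>simp add: radial_solution_def\<close>)

subsection \<open>Augmentation\<close>

text \<open>The inverse of the reduction step. Only \<open>a 0\<close> and \<open>a 1\<close> enter;
  the higher coefficients are carried by \<open>g\<close>.\<close>

definition augment :: "real \<Rightarrow> (nat \<Rightarrow> real) \<Rightarrow> (complex \<Rightarrow> complex) \<Rightarrow> complex \<Rightarrow> complex" where
  "augment x a g z = of_real (a 0) + 1 / (of_real (1 / a 1) / (z - of_real x) - g z)"

text \<open>With \<open>inverse 0 = 0\<close> the reciprocal is injective everywhere, so no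
  denominator has to be shown nonzero.\<close>

lemma augment_inject: "augment x a f z = augment x a g z \<longleftrightarrow> f z = g z"
  by (simp add: augment_def divide_inverse)

text \<open>The denominator takes values in the open lower half-plane, so it never vanishes and its
  reciprocal has positive imaginary part.\<close>

lemma augment_in_pick_class:
  assumes g: "g \<in> pick_class" and a1: "a 1 > 0"
  shows "augment x a g \<in> pick_class"
proof -
  define D where "D = (\<lambda>z. of_real (1 / a 1) / (z - of_real x) - g z)"
  have ImD: "Im (D z) < 0" if z: "z \<in> upper_half_plane" for z
  proof -
    have "Im z > 0" "cmod (z - of_real x) > 0" using z by (auto simp: upper_half_plane_def)
    then have "0 < Im z / (a 1 * (cmod (z - of_real x))\<^sup>2)"
      using a1 by (intro divide_pos_pos mult_pos_pos zero_less_power)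
    moreover have "Im (g z) \<ge> 0" using g z by (simp add: pick_class_def)
    moreover have "Im (of_real (1 / a 1) / (z - of_real x)) = - (Im z / (a 1 * (cmod (z - of_real x))\<^sup>2))"
      by (simp only: Im_of_real_divide minus_complex.sel Im_complex_of_real diff_zero mult_1
          times_divide_eq_left divide_divide_eq_left)
    ultimately show ?thesis unfolding D_def minus_complex.sel by linarith
  qed
  show ?thesis
    unfolding pick_class_def
  proof (intro CollectI conjI ballI)
    have "D z \<noteq> 0" "z - of_real x \<noteq> 0" if "z \<in> upper_half_plane" for z
      using ImD[OF that] that by (auto simp: upper_half_plane_def)
    moreover have "g holomorphic_on upper_half_plane" using g by (simp add: pick_class_def)
    ultimately show "augment x a g holomorphic_on upper_half_plane"
      unfolding augment_def[abs_def] D_def by (intro holomorphic_intros) auto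
    fix z assume "z \<in> upper_half_plane"
    then have "- Im (D z) / (cmod (D z))\<^sup>2 \<ge> 0" using ImD[of z] by (intro divide_nonneg_nonneg) auto
    moreover have "augment x a g z = of_real (a 0) + 1 / D z" by (simp add: augment_def D_def)
    ultimately show "Im (augment x a g z) \<ge> 0" by (simp add: Im_1_divide)
  qed
qed

text \<open>Clearing \<open>z - x\<close> gives \<open>a 0 + (z - x) / D z\<close> with
  \<open>D x = 1 / a 1 \<noteq> 0\<close>, which removes the singularity at \<open>x\<close>. The
  expansion is assumed for \<open>D\<close>, not for \<open>h\<close>, so that both the inductive
  step and the constant start fit.\<close>

lemma analytic_solution_augment:
  assumes g: "g \<in> pick_class" and a1: "a 1 > 0"
    and ext: "open U" "of_real x \<in> U" "h holomorphic_on U" "\<And>z. z \<in> U \<inter> upper_half_plane \<Longrightarrow> h z = g z"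
    and ex: "expands (at (of_real x)) (of_real x) n (\<lambda>k. of_real (recip a k))
      (\<lambda>z. of_real (1 / a 1) - (z - of_real x) * h z)"
  shows "analytic_solution x (Suc n) a (augment x a g)"
  unfolding analytic_solution_iff_expands
proof (intro conjI exI ballI)
  show "augment x a g \<in> pick_class" by (rule augment_in_pick_class[of g a, OF g a1])
  let ?x = "complex_of_real x"
  define D where "D = (\<lambda>z. of_real (1 / a 1) - (z - ?x) * h z)"
  define V where "V = U \<inter> D -` (- {0})"
  define F where "F = (\<lambda>z. of_real (a 0) + (z - ?x) / D z)"
  have D: "D holomorphic_on U" unfolding D_def by (intro holomorphic_intros ext)
  show "open V" unfolding V_def
    by (rule continuous_open_preimage[OF holomorphic_on_imp_continuous_on[OF D] ext(1)]) auto
  show "?x \<in> V" using ext(2) a1 by (simp add: V_def D_def)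
  show "F holomorphic_on V"
    unfolding F_def by (intro holomorphic_intros holomorphic_on_subset[OF D]) (auto simp: V_def)
  show "F z = augment x a g z" if z: "z \<in> V \<inter> upper_half_plane" for z
  proof -
    have "z \<noteq> ?x" using z by (auto simp: upper_half_plane_def)
    moreover have "h z = g z" using ext(4) z by (simp add: V_def)
    ultimately have "of_real (1 / a 1) / (z - ?x) - g z = D z / (z - ?x)"
      by (simp add: D_def diff_divide_distrib)
    then show ?thesis by (simp add: F_def augment_def)
  qed
  have "expands (at ?x) ?x n (\<lambda>k. of_real (a (Suc k))) (\<lambda>z. 1 / D z)"
    unfolding D_def by (rule expands_inverse[OF order_refl ex]) (rule of_real_sum_recip(2), use a1 in simp)
  also have "?this \<longleftrightarrow> expands (at ?x) ?x n (\<lambda>k. of_real (a (Suc k)))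
      (\<lambda>z. (F z - of_real (a 0)) / (z - ?x))"
  proof (rule expands_cong)
    show "\<forall>\<^sub>F z in at ?x. 1 / D z = (F z - of_real (a 0)) / (z - ?x)"
      using eventually_neq_of_le_at[OF order_refl, of ?x] by eventually_elim (simp add: F_def)
  qed simp
  finally show "expands (at ?x) ?x (Suc n) (\<lambda>k. of_real (a k)) F"
    unfolding expands_Suc[OF order_refl] .
qed

lemma analytic_solution_augment_step:
  assumes "analytic_solution x n (reduce a) g" and a1: "a 1 > 0"
  shows "analytic_solution x (Suc (Suc n)) a (augment x a g)"
proof -
  let ?x = "complex_of_real x"
  obtain h U where h: "g \<in> pick_class" "open U" "of_real x \<in> U" "h holomorphic_on U"
      "\<And>z. z \<in> U \<inter> upper_half_plane \<Longrightarrow> h z = g z"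
      "expands (at ?x) ?x n (\<lambda>k. of_real (reduce a k)) h"
    using assms(1) unfolding analytic_solution_iff_expands by metis
  have "expands (at ?x) ?x n (\<lambda>k. - 1 * of_real (reduce a k)) (\<lambda>z. - 1 * h z)"
    by (rule expands_cmult[OF h(6)])
  also have "?this \<longleftrightarrow> expands (at ?x) ?x n (\<lambda>k. of_real (recip a (Suc k)))
     (\<lambda>z. (of_real (1 / a 1) - (z - ?x) * h z - of_real (recip a 0)) / (z - ?x))"
  proof (rule expands_cong)
    show "\<forall>\<^sub>F z in at ?x. - 1 * h z =
        (of_real (1 / a 1) - (z - ?x) * h z - of_real (recip a 0)) / (z - ?x)"
      using eventually_neq_of_le_at[OF order_refl, of ?x] by eventually_elim (simp add: recip_0)
  qed (simp add: reduce_def)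
  finally have "expands (at ?x) ?x (Suc n) (\<lambda>k. of_real (recip a k))
     (\<lambda>z. of_real (1 / a 1) - (z - ?x) * h z)"
    unfolding expands_Suc[OF order_refl] .
  with h a1 show ?thesis by (intro analytic_solution_augment[where U = U and h = h])
qed

text \<open>At order 1 the data do not constrain the reduced function; the free real parameter
  \<open>t\<close> is the source of non-uniqueness.\<close>

lemma analytic_solution_augment_const:
  assumes a1: "a 1 > 0"
  shows "analytic_solution x 1 a (augment x a (\<lambda>_. of_real t))"
  unfolding One_nat_def
proof (rule analytic_solution_augment[where U = UNIV and h = "\<lambda>_. of_real t"])
  let ?x = "complex_of_real x"
  have "((\<lambda>z. of_real (1 / a 1) - (z - ?x) * of_real t) \<longlongrightarrow> of_real (1 / a 1) - (?x - ?x) * of_real t) (at ?x)"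
    by (intro tendsto_intros)
  then show "expands (at ?x) ?x 0 (\<lambda>k. of_real (recip a k)) (\<lambda>z. of_real (1 / a 1) - (z - ?x) * of_real t)"
    by (simp add: expands_0 recip_0)
qed (use a1 in \<open>auto simp: pick_class_def\<close>)

text \<open>The chain is built up from the constants 0 and 1, and \<open>augment_inject\<close>
  carries their difference through every step.\<close>

lemma hankel_pd_analytic_solutions:
  "hankel_pd m a \<Longrightarrow> \<exists>f g. analytic_solution x (2 * m - 1) a f \<and> analytic_solution x (2 * m - 1) a g \<and>
     (\<exists>z\<in>upper_half_plane. f z \<noteq> g z)"
proof (induction rule: hankel_pd.induct)
  case (base a)
  have "\<i> \<in> upper_half_plane" by (simp add: upper_half_plane_def)
  moreover have "augment x a (\<lambda>_. of_real 0) \<i> \<noteq> augment x a (\<lambda>_. of_real 1) \<i>"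
    unfolding augment_inject by simp
  moreover have "2 * 1 - 1 = (1::nat)" by simp
  ultimately show ?case
    using analytic_solution_augment_const[of a, OF base, of x 0]
      analytic_solution_augment_const[of a, OF base, of x 1]
    by metis
next
  case (step a m)
  have n: "2 * Suc m - 1 = Suc (Suc (2 * m - 1))" using hankel_pd_ge_1[OF step.hyps(2)] by simp
  from step.IH obtain f g z where "analytic_solution x (2 * m - 1) (reduce a) f"
      "analytic_solution x (2 * m - 1) (reduce a) g" "z \<in> upper_half_plane" "f z \<noteq> g z" by blast
  then have "analytic_solution x (Suc (Suc (2 * m - 1))) a (augment x a f)"
      "analytic_solution x (Suc (Suc (2 * m - 1))) a (augment x a g)"
      "z \<in> upper_half_plane" "augment x a f z \<noteq> augment x a g z"
    using step.hyps(1) by (auto simp: augment_inject intro: analytic_solution_augment_step)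
  then show ?case unfolding n by blast
qed

lemma hankel_se_analytic_solution:
  "hankel_se m r a \<Longrightarrow> \<exists>f. analytic_solution x (2 * m - 1) a f"
proof (induction rule: hankel_se.induct)
  case (base m a)
  have "expands (at (of_real x)) (of_real x) (2 * m - 1) (\<lambda>k. of_real (a k)) (\<lambda>_. of_real (a 0))"
    using expands_const
    by (rule iffD1[OF expands_cong, rotated -1]) (use base in auto)
  then have "analytic_solution x (2 * m - 1) a (\<lambda>_. of_real (a 0))"
    unfolding analytic_solution_iff_expands
    by (intro conjI exI[of _ UNIV] exI[of _ "\<lambda>_. of_real (a 0)"]) (auto simp: pick_class_def)
  then show ?case by blast
next
  case (step a m r)
  have n: "2 * Suc m - 1 = Suc (Suc (2 * m - 1))" using hankel_se_bounds[OF step.hyps(2)] by simp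
  from step.IH obtain f where "analytic_solution x (2 * m - 1) (reduce a) f" ..
  then have "analytic_solution x (Suc (Suc (2 * m - 1))) a (augment x a f)"
    using step.hyps(1) by (auto intro: analytic_solution_augment_step)
  then show ?case unfolding n by blast
qed

section \<open>Necessity of the Hankel condition and uniqueness\<close>

lemma ray_solution_reduce:
  assumes "ray_solution x (Suc (Suc n)) a f" "a 1 > 0"
  obtains g where "ray_solution x n (reduce a) g"
    and "\<And>z. z \<in> upper_half_plane \<Longrightarrow> f z = augment x a g z"
proof -
  note f = assms(1)[unfolded ray_solution_def]
  show thesis
  proof (rule that)
    show "ray_solution x n (reduce a) (\<lambda>z. of_real (1 / a 1) / (z - of_real x) - 1 / (f z - of_real (a 0)))"
      unfolding ray_solution_def
      using pick_class_reduce(1,2)[of f x n a, OF conjunct1[OF f] conjunct2[OF f] assms(2)] by (rule conjI)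
    show "f z = augment x a (\<lambda>z. of_real (1 / a 1) / (z - of_real x) - 1 / (f z - of_real (a 0))) z"
      if "z \<in> upper_half_plane" for z
      unfolding augment_def
      by (rule pick_class_reduce(3)[of f x n a, OF conjunct1[OF f] conjunct2[OF f] assms(2) that])
  qed
qed

lemma ray_solution_const:
  assumes "ray_solution x n a f" "n \<ge> 1" "a 1 \<le> 0"
  shows "z \<in> upper_half_plane \<Longrightarrow> f z = of_real (a 0)" and "k \<in> {1..n} \<Longrightarrow> a k = 0"
proof -
  note f = assms(1)[unfolded ray_solution_def]
  note const = pick_class_constant_if_deriv_nonpos[of f x n a, OF conjunct1[OF f] conjunct2[OF f] assms(2,3)]
  show "z \<in> upper_half_plane \<Longrightarrow> f z = of_real (a 0)" by (rule const(1))
  show "k \<in> {1..n} \<Longrightarrow> a k = 0" by (rule const(2))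
qed

lemma ray_solution_imp_hankel:
  "m \<ge> 1 \<Longrightarrow> ray_solution x (2 * m - 1) a f \<Longrightarrow> hankel_pd m a \<or> (\<exists>r. hankel_se m r a)"
proof (induction m arbitrary: a f)
  case (Suc m)
  show ?case
  proof (cases "a 1 > 0")
    case a1: True
    show ?thesis
    proof (cases "m = 0")
      case True
      with hankel_pd.base[of a, OF a1] show ?thesis by simp
    next
      case False
      then have "2 * Suc m - 1 = Suc (Suc (2 * m - 1))" by simp
      with Suc.prems(2) a1 obtain g where "ray_solution x (2 * m - 1) (reduce a) g"
        using ray_solution_reduce by metis
      then have "hankel_pd m (reduce a) \<or> (\<exists>r. hankel_se m r (reduce a))"
        using Suc.IH False by simp
      then show ?thesis using a1 by (blast intro: hankel_pd.step hankel_se.step)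
    qed
  next
    case False
    then have "hankel_se (Suc m) 0 a"
      using ray_solution_const(2)[OF Suc.prems(2)] by (intro hankel_se.base) auto
    then show ?thesis by blast
  qed
qed simp

text \<open>Both functions are recovered by the same \<open>augment x a\<close>, so equality is
  inherited from the end of the chain, where both are the constant \<open>a 0\<close>.\<close>

lemma hankel_se_ray_solution_unique:
  "hankel_se m r a \<Longrightarrow> ray_solution x (2 * m - 1) a f \<Longrightarrow> ray_solution x (2 * m - 1) a g \<Longrightarrow>
   z \<in> upper_half_plane \<Longrightarrow> f z = g z"
proof (induction arbitrary: f g rule: hankel_se.induct)
  case (base m a)
  have "a 1 = 0" using base by auto
  with base.hyps ray_solution_const(1)[OF base.prems(1) _ _ base.prems(3)]
    ray_solution_const(1)[OF base.prems(2) _ _ base.prems(3)] show ?case by simp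
next
  case (step a m r)
  have n: "2 * Suc m - 1 = Suc (Suc (2 * m - 1))" using hankel_se_bounds[OF step.hyps(2)] by simp
  obtain f' where f': "ray_solution x (2 * m - 1) (reduce a) f'" "f z = augment x a f' z"
    using ray_solution_reduce[of x "2 * m - 1" a f] step.prems step.hyps(1) unfolding n by metis
  obtain g' where g': "ray_solution x (2 * m - 1) (reduce a) g'" "g z = augment x a g' z"
    using ray_solution_reduce[of x "2 * m - 1" a g] step.prems step.hyps(1) unfolding n by metis
  show ?case
    unfolding f'(2) g'(2) augment_inject by (rule step.IH[OF f'(1) g'(1) step.prems(3)])
qed

section \<open>Degree of the rational solution\<close>

lemma coprime_augment_poly:
  fixes p q :: "'a::field_gcd poly"
  assumes pq: "coprime p q" and c: "c \<noteq> 0" and qx: "poly q x \<noteq> 0"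
  defines "d \<equiv> [:c:] * q - [:-x, 1:] * p"
  shows "coprime ([:b:] * d + [:-x, 1:] * q) d"
proof -
  \<comment> \<open>These rules would multiply out the products whose factors the divisibility
    arguments need.\<close>
  note [simp del] = mult_pCons_left mult_pCons_right
  \<comment> \<open>Modulo \<open>[:-x, 1:]\<close> the polynomial \<open>q\<close> is the nonzero
    constant \<open>poly q x\<close>.\<close>
  have unit: "is_unit e" if "e dvd [:-x, 1:]" "e dvd q" for e
  proof -
    have "[:-x, 1:] dvd q - [:poly q x:]" by (simp add: poly_eq_0_iff_dvd[symmetric])
    with that have "e dvd q - (q - [:poly q x:])" by (meson dvd_diff dvd_trans)
    then have "e dvd [:poly q x:]" by simp
    moreover have "is_unit [:poly q x:]" using qx by (simp add: is_unit_const_poly_iff)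
    ultimately show ?thesis by (rule dvd_trans)
  qed
  have cq: "e dvd q" if "e dvd [:c:] * q" for e
  proof -
    from that have "e dvd [:inverse c:] * ([:c:] * q)" by (rule dvd_mult)
    moreover have "[:inverse c:] * ([:c:] * q) = q" using c by (simp add: mult_pCons_left)
    ultimately show ?thesis by simp
  qed
  have "coprime d [:-x, 1:]"
  proof (rule coprimeI)
    fix e assume e: "e dvd d" "e dvd [:-x, 1:]"
    then have "e dvd d + [:-x, 1:] * p" by (intro dvd_add) auto
    then have "e dvd q" by (intro cq) (simp add: d_def)
    with e show "is_unit e" by (intro unit)
  qed
  moreover have "coprime d q"
  proof (rule coprimeI)
    fix e assume e: "e dvd d" "e dvd q"
    then have "e dvd [:c:] * q - d" by (intro dvd_diff) auto
    then have "e dvd [:-x, 1:] * p" by (simp add: d_def)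
    moreover have "coprime e p" 
      using coprime_divisors[OF e(2) dvd_refl, of p] pq by (simp add: coprime_commute)
    ultimately have "e dvd [:-x, 1:]" by (simp add: coprime_dvd_mult_left_iff)
    with e show "is_unit e" by (intro unit)
  qed
  \<comment> \<open>Modulo \<open>d\<close> the numerator is \<open>[:-x, 1:] * q\<close>, so this
    is the coprimality that is needed.\<close>
  ultimately have *: "coprime d ([:-x, 1:] * q)" by simp
  show ?thesis
  proof (rule coprimeI)
    fix e assume e: "e dvd [:b:] * d + [:-x, 1:] * q" "e dvd d"
    then have "e dvd ([:b:] * d + [:-x, 1:] * q) - [:b:] * d" by (intro dvd_diff) auto
    then have "e dvd [:-x, 1:] * q" by simp
    with * e(2) show "is_unit e" by (rule coprime_common_divisor)
  qed
qed

text \<open>If \<open>p\<close> is nonzero of degree at least that of \<open>q\<close>, then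
  \<open>[:-x, 1:] * p\<close> dominates \<open>d\<close>; otherwise \<open>[:-x, 1:] * q\<close>
  dominates the numerator. Either way the linear factor raises the maximum by one.\<close>

lemma degree_augment_poly:
  fixes p q :: "'a::field poly" and x :: 'a
  assumes c: "c \<noteq> 0" and q: "q \<noteq> 0"
  defines "d \<equiv> [:c:] * q - [:-x, 1:] * p"
  shows "max (Polynomial.degree ([:b:] * d + [:-x, 1:] * q)) (Polynomial.degree d) =
    Suc (max (Polynomial.degree p) (Polynomial.degree q))"
proof -
  have deg: "Polynomial.degree ([:-x, 1:] * u) = Suc (Polynomial.degree u)" if "u \<noteq> 0" for u :: "'a poly"
    using that by (subst degree_mult_eq) auto
  have degc: "Polynomial.degree ([:b:] * u) \<le> Polynomial.degree u" for b and u :: "'a poly"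
    using degree_mult_le[of "[:b:]" u] by simp
  show ?thesis
  proof (cases "p \<noteq> 0 \<and> Polynomial.degree p \<ge> Polynomial.degree q")
    case True
    then have "Polynomial.degree ([:c:] * q) < Polynomial.degree (- ([:-x, 1:] * p))"
      using degc[of c q] deg[of p] by (simp del: mult_pCons_left)
    then have d: "Polynomial.degree d = Suc (Polynomial.degree p)"
      unfolding d_def diff_conv_add_uminus using deg[of p] True
      by (subst degree_add_eq_right) (simp_all del: mult_pCons_left)
    have "Polynomial.degree ([:b:] * d + [:-x, 1:] * q) \<le> Suc (Polynomial.degree p)"
      using degc[of b d] deg[OF q] d True by (intro degree_add_le) auto
    with d True show ?thesis by simp
  next
    case False
    then have pq: "p = 0 \<or> Polynomial.degree p < Polynomial.degree q" by auto
    have "Polynomial.degree ([:-x, 1:] * p) \<le> Polynomial.degree q"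
      using pq deg[of p] by (cases "p = 0") auto
    then have d: "Polynomial.degree d \<le> Polynomial.degree q"
      unfolding d_def using degc[of c q] by (intro degree_diff_le)
    have "Polynomial.degree ([:b:] * d) < Polynomial.degree ([:-x, 1:] * q)"
      using degc[of b d] d deg[OF q] by simp
    then have "Polynomial.degree ([:b:] * d + [:-x, 1:] * q) = Suc (Polynomial.degree q)"
      using deg[OF q] by (subst degree_add_eq_right) simp_all
    with d pq show ?thesis by auto
  qed
qed

text \<open>The condition \<open>poly q x \<noteq> 0\<close> makes the induction go through: it keeps the
  fraction of the augmented function in lowest terms.\<close>

lemma hankel_se_ray_solution_rational:
  "hankel_se m r a \<Longrightarrow> ray_solution x (2 * m - 1) a f \<Longrightarrow>
   \<exists>p q. coprime p q \<and> max (Polynomial.degree p) (Polynomial.degree q) = r \<and> poly q (of_real x) \<noteq> 0 \<and>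
     (\<forall>z\<in>upper_half_plane. poly q z \<noteq> 0 \<and> f z = poly p z / poly q z)"
proof (induction arbitrary: f rule: hankel_se.induct)
  case (base m a)
  have "a 1 = 0" using base by auto
  with base.hyps ray_solution_const(1)[OF base.prems] have "f z = of_real (a 0)" if "z \<in> upper_half_plane" for z
    using that by simp
  then show ?case by (intro exI[of _ "[:of_real (a 0):]"] exI[of _ 1]) auto
next
  case (step a m r)
  let ?x = "complex_of_real x"
  have n: "2 * Suc m - 1 = Suc (Suc (2 * m - 1))" using hankel_se_bounds[OF step.hyps(2)] by simp
  obtain g where g: "ray_solution x (2 * m - 1) (reduce a) g"
      "\<And>z. z \<in> upper_half_plane \<Longrightarrow> f z = augment x a g z"
    using ray_solution_reduce[of x "2 * m - 1" a f] step.prems step.hyps(1) unfolding n by metis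
  obtain p q where pq: "coprime p q" "max (Polynomial.degree p) (Polynomial.degree q) = r"
      "poly q ?x \<noteq> 0" "\<And>z. z \<in> upper_half_plane \<Longrightarrow> poly q z \<noteq> 0 \<and> g z = poly p z / poly q z"
    using step.IH[OF g(1)] by blast
  define c where "c = complex_of_real (1 / a 1)"
  have c: "c \<noteq> 0" using step.hyps(1) by (simp add: c_def)
  \<comment> \<open>Obtained by inserting \<open>p / q\<close> for \<open>g\<close> in
    \<open>augment\<close> and clearing \<open>z - x\<close> and \<open>q\<close>.\<close>
  define D where "D = [:c:] * q - [:- ?x, 1:] * p"
  define N where "N = [:of_real (a 0):] * D + [:- ?x, 1:] * q"
  have q0: "q \<noteq> 0" using pq(3) by auto
  have "poly D z \<noteq> 0 \<and> f z = poly N z / poly D z" if z: "z \<in> upper_half_plane" for z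
  proof -
    have zx: "z - ?x \<noteq> 0" using z by (auto simp: upper_half_plane_def)
    note qz = pq(4)[OF z]
    have "f z \<noteq> of_real (a 0)"
      using step.prems step.hyps(1) n pick_class_ne_boundary_value[OF _ _ _ _ z, of f x "2 * Suc m - 1" a]
      by (simp add: ray_solution_def)
    then have ne: "c / (z - ?x) - g z \<noteq> 0" using g(2)[OF z] by (auto simp: augment_def c_def)
    have D: "poly D z = (z - ?x) * poly q z * (c / (z - ?x) - g z)"
      using zx qz by (simp add: D_def field_simps)
    with ne zx qz have D0: "poly D z \<noteq> 0" by simp
    have "f z = of_real (a 0) + (z - ?x) * poly q z / poly D z"
      unfolding g(2)[OF z] augment_def D c_def[symmetric] using zx qz by simp
    also have "\<dots> = poly N z / poly D z"
      using D0 by (simp add: N_def field_simps del: mult_pCons_left)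
    finally show ?thesis using D0 by simp
  qed
  moreover have "coprime N D" unfolding N_def D_def by (rule coprime_augment_poly[OF pq(1) c pq(3)])
  moreover have "max (Polynomial.degree N) (Polynomial.degree D) = Suc r"
    unfolding N_def D_def degree_augment_poly[OF c q0] pq(2) ..
  \<comment> \<open>At \<open>x\<close> the term with \<open>p\<close> vanishes and
    \<open>c * poly q x\<close> remains.\<close>
  moreover have "poly D ?x \<noteq> 0" using c pq(3) by (simp add: D_def)
  ultimately show ?case by blast
qed

section \<open>Assembly of the equivalences\<close>

theorem theorem5p1:
  fixes n m :: nat and x :: real and a :: "nat \<Rightarrow> real"
  assumes "odd n" and "n = 2 * m - 1"
  shows
    "((\<exists>f. weak_solution x n a f) \<longleftrightarrow> (\<exists>f. nontangential_solution x n a f)) \<and>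
     ((\<exists>f. nontangential_solution x n a f) \<longleftrightarrow> (\<exists>f. radial_solution x n a f)) \<and>
     ((\<exists>f. radial_solution x n a f) \<longleftrightarrow> (\<exists>f. analytic_solution x n a f)) \<and>
     ((\<exists>f. analytic_solution x n a f) \<longleftrightarrow>
        pos_def_mat (hankel m a) \<or> SE_minimally_positive (hankel m a)) \<and>
     ((\<exists>f. weak_solution x n a f \<and>
           (\<forall>g. weak_solution x n a g \<longrightarrow> (\<forall>z\<in>upper_half_plane. g z = f z))) \<longleftrightarrow>
        SE_minimally_positive (hankel m a)) \<and>
     (SE_minimally_positive (hankel m a) \<longrightarrow>
        (\<forall>f. weak_solution x n a f \<longrightarrow>
           rational_on_upper_half_plane (vec_space.rank m (hankel m a)) f))"
proof -
  \<comment> \<open>With natural subtraction \<open>m = 0\<close> would give \<open>n = 0\<close>,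
    which is not odd.\<close>
  have m: "m \<ge> 1" using assms by (cases m) auto
  note pd = pos_def_hankel_iff[OF m, of a] and se = SE_minimally_positive_hankel_iff[OF m, of a]
  have nec: "pos_def_mat (hankel m a) \<or> SE_minimally_positive (hankel m a)" if "ray_solution x n a f" for f
    unfolding pd se using ray_solution_imp_hankel[OF m] that assms(2) by blast
  have suf: "\<exists>f. analytic_solution x n a f"
    if "pos_def_mat (hankel m a) \<or> SE_minimally_positive (hankel m a)"
    using that hankel_pd_analytic_solutions hankel_se_analytic_solution unfolding pd se assms(2) by blast
  have unique: "g z = f z" if "SE_minimally_positive (hankel m a)" "weak_solution x n a f"
    "weak_solution x n a g" "z \<in> upper_half_plane" for f g z
    using that hankel_se_ray_solution_unique weak_imp_ray_solution unfolding se assms(2) by metis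
  \<comment> \<open>No \<open>f\<close> can agree with both of two analytic solutions that differ
    somewhere in the half-plane.\<close>
  have not_unique: "\<not> (\<forall>g. weak_solution x n a g \<longrightarrow> (\<forall>z\<in>upper_half_plane. g z = f z))"
    if "pos_def_mat (hankel m a)" for f
    using hankel_pd_analytic_solutions[of m a x] that analytic_imp_weak_solution
    unfolding pd assms(2) by metis
  have rational: "rational_on_upper_half_plane (vec_space.rank m (hankel m a)) f"
    if SE: "SE_minimally_positive (hankel m a)" and weak: "weak_solution x n a f" for f
  proof -
    obtain r where r: "hankel_se m r a" using SE unfolding se ..
    obtain p q where "coprime p q" "max (Polynomial.degree p) (Polynomial.degree q) = r"
        "poly q (of_real x) \<noteq> 0" "\<forall>z\<in>upper_half_plane. poly q z \<noteq> 0 \<and> f z = poly p z / poly q z"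
      using hankel_se_ray_solution_rational[OF r] weak_imp_ray_solution[OF weak] unfolding assms(2) by blast
    then show ?thesis
      unfolding rational_on_upper_half_plane_def rank_hankel[OF r] by (metis poly_0)
  qed
  \<comment> \<open>A weak solution yields one of the two Hankel conditions by \<open>nec\<close>;
    uniqueness rules out the definite one.\<close>
  have "(\<exists>f. weak_solution x n a f \<and>
           (\<forall>g. weak_solution x n a g \<longrightarrow> (\<forall>z\<in>upper_half_plane. g z = f z))) \<longleftrightarrow>
        SE_minimally_positive (hankel m a)"
    using nec suf unique not_unique weak_imp_ray_solution analytic_imp_weak_solution by metis
  \<comment> \<open>The circle closes: every kind of solution gives a ray solution, which gives the
    Hankel condition, which gives an analytic solution, which is a solution of every kind.\<close>
  then show ?thesis
    using nec suf rational weak_imp_ray_solution analytic_imp_weak_solution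
      analytic_imp_nontangential_solution nontangential_imp_radial_solution radial_imp_ray_solution
    by metis
qed

end
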